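(* Let $X_t = dt+\sigma B_t-\sum_{j=1}^{N_t}C_j$, $t\ge 0$, where $d\in\mathbb{R}$, $\sigma>0$, $B$ is a standard Brownian motion, $N$ is a Poisson process with rate $\lambda>0$, and $\{C_j\}_{j\ge1}$ are i.i.d. random variables having a matrix-exponential distribution on $(0,\infty)$ with minimal standardized representation $(\boldsymbol{\alpha},\boldsymbol{T})$ of order $p\in\mathbb{N}$, with $B$, $N$, $\{C_j\}$ independent, and $\boldsymbol{t}:=-\boldsymbol{T}\boldsymbol{1}$. Let $\psi$ be the Laplace exponent of $X$, and for $q\ge 0$ let $\Phi_q$ be the largest root of $\psi(\theta)=q$ in $[0,\infty)$ and $W^{(q)}$ the $q$-scale function of $X$. Let $q\ge 0$ be such that $\psi'(\Phi_q)>0$, and set $$\omega:=\frac{\sqrt{d^2+2\sigma^2(\lambda+q)}+d}{\sigma^{2}},\qquad \eta:=\frac{\sqrt{d^2+2\sigma^2(\lambda+q)}-d}{\sigma^{2}}.$$ Define $a_n\in\mathbb{R}$ and $\boldsymbol{b}_n\in\mathbb{R}^{1\times p}$ by $a_0=\omega$, $\boldsymbol{b}_0=\boldsymbol{0}$ and, for $n\ge 1$, $$\boldsymbol{b}_n=\Big(\frac{2\lambda}{\sigma^2}\boldsymbol{\alpha}+(\omega-a_{n-1})\boldsymbol{b}_{n-1}\Big)\big(\eta\boldsymbol{I}-\boldsymbol{T}\big)^{-1},$$ $$a_n=\omega-\frac{\sigma^2}{2\sqrt{d^2+2\sigma^2(\lambda+q)}}\Big((\omega-a_{n-1})^2+\boldsymbol{b}_n\boldsymbol{t}\Big).$$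 Then $(a_n,\boldsymbol{b}_n)$ converges entrywise to a pair $(a,\boldsymbol{b})\in\mathbb{R}\times\mathbb{R}^{1\times p}$, which is a solution to the system $$\sigma^2a^2-2da-2(\lambda+q)+\sigma^2\boldsymbol{b}\boldsymbol{t}=0,\qquad \sigma^2\boldsymbol{b}\Big(\big(a-2d\sigma^{-2}\big)\boldsymbol{I}-\boldsymbol{T}\Big)=2\lambda\boldsymbol{\alpha}.$$ Moreover, put $$\boldsymbol{\Psi}:=\frac1\omega\begin{pmatrix}\omega-a & \boldsymbol{b}\end{pmatrix}\in\mathbb{R}^{1\times(p+1)},\qquad \boldsymbol{C}^-:=\begin{pmatrix}-\omega&\boldsymbol{0}\\ \boldsymbol{t}&\boldsymbol{T}\end{pmatrix},\qquad \boldsymbol{D}^{-+}:=\begin{pmatrix}\omega\\ \boldsymbol{0}\end{pmatrix},$$ $$\boldsymbol{G}:=\boldsymbol{C}^-+\boldsymbol{D}^{-+}\boldsymbol{\Psi}=\begin{pmatrix}-a&\boldsymbol{b}\\ \boldsymbol{t}&\boldsymbol{T}\end{pmatrix}\in\mathbb{R}^{(p+1)\times(p+1)},$$ $\boldsymbol{\nu}:=(\Phi_q\boldsymbol{I}-\boldsymbol{T})^{-1}\boldsymbol{t}$, $\boldsymbol{V}:=\begin{pmatrix}1\\ \boldsymbol{\nu}\end{pmatrix}\in\mathbb{R}^{p+1}$, and $\boldsymbol{e}_1^-:=(1,0,\dots,0)^{\top}\in\mathbb{R}^{p+1}$. Then $$W^{(q)}(x)=\frac{1}{\psi'(\Phi_q)}\Big(e^{\Phi_q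 x}-(\boldsymbol{e}_1^-)^{\top}e^{\boldsymbol{G}x}\,\boldsymbol{V}\Big)\qquad\text{for all } x\ge 0.$$
   Context: A distribution on $(0,\infty)$ is matrix-exponential if it has a density of the form $f(x)=\boldsymbol{\alpha}e^{\boldsymbol{T}x}\boldsymbol{t}$, $x>0$, with $\boldsymbol{\alpha}$ a $1\times p$ row vector, $\boldsymbol{T}$ a $p\times p$ matrix and $\boldsymbol{t}$ a $p\times1$ column vector (no sign constraints on the entries; the only requirement is that $f$ is a probability density). A standardized representation $(\boldsymbol{\alpha},\boldsymbol{T})$ of order $p$ is one with real entries such that $\boldsymbol{\alpha}\boldsymbol{1}=1$ and $\boldsymbol{t}=-\boldsymbol{T}\boldsymbol{1}$, where $\boldsymbol{1}$ is the column vector of ones. It is minimal if the Laplace transform $\boldsymbol{\alpha}(\theta\boldsymbol{I}-\boldsymbol{T})^{-1}\boldsymbol{t}$, written as a ratio $P(\theta)/Q(\theta)$ of polynomials with no common factors, has $\deg Q=p$. $\boldsymbol{I}$ is the identity matrix. The Laplace exponent of $X$ is $\psi(\theta)=\log\mathbb{E}[e^{\theta X_1}]=d\theta+\tfrac{\sigma^2}{2}\theta^2+\lambda\big(\boldsymbol{\alpha}(\theta\boldsymbol{I}-\boldsymbol{T})^{-1}\boldsymbol{t}-1\big)$, $\theta\ge 0$ (with $\psi'(0)$ the right derivative at $0$). For $q\ge 0$, $\Phi_q\ge 0$ is the largest root of $\psi(\theta)=q$. The $q$-scale function $W^{(q)}:\mathbb{R}\to[0,\infty)$ is the function that vanishes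 on $(-\infty,0)$, is continuous on $[0,\infty)$, and is characterized there by $\int_0^\infty e^{-\theta x}W^{(q)}(x)\,dx=\frac{1}{\psi(\theta)-q}$ for $\theta>\Phi_q$. *)

theory Defs
  imports "HOL-Probability.Probability" "HOL-Computational_Algebra.Computational_Algebra"
begin

text \<open>
  Row and column vectors of length \<open>p\<close> are both elements of \<open>real ^ 'p\<close> with \<open>p = CARD('p)\<close>; the
  product of a row \<open>u\<close> and a column \<open>v\<close> is \<open>u \<bullet> v\<close>, and \<open>mat c\<close> is \<open>c\<close> times the identity matrix.
\<close>

definition mat_exp :: "real ^ 'n ^ 'n \<Rightarrow> real ^ 'n ^ 'n" where
  "mat_exp A = (\<Sum>n. (((**) A) ^^ n) (mat 1) /\<^sub>R fact n)"

definition exit_vector :: "real ^ 'p ^ 'p \<Rightarrow> real ^ 'p" where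
  "exit_vector T = - (T *v vec 1)"

definition me_density :: "real ^ 'p \<Rightarrow> real ^ 'p ^ 'p \<Rightarrow> real \<Rightarrow> real" where
  "me_density \<alpha> T x = (if x > 0 then \<alpha> \<bullet> (mat_exp (x *\<^sub>R T) *v exit_vector T) else 0)"

text \<open>
  Nonnegativity is demanded separately because \<open>ennreal\<close> truncates negative values to \<open>0\<close>.
\<close>

definition standardized_me_rep ::
  "'w measure \<Rightarrow> ('w \<Rightarrow> real) \<Rightarrow> real ^ 'p \<Rightarrow> real ^ 'p ^ 'p \<Rightarrow> bool" where
  "standardized_me_rep M Y \<alpha> T \<longleftrightarrow>
     \<alpha> \<bullet> vec 1 = 1 \<and>
     (\<forall>x. me_density \<alpha> T x \<ge> 0) \<and>
     distributed M lborel Y (\<lambda>x. ennreal (me_density \<alpha> T x))"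

definition me_laplace :: "real ^ 'p \<Rightarrow> real ^ 'p ^ 'p \<Rightarrow> real \<Rightarrow> real" where
  "me_laplace \<alpha> T \<theta> = \<alpha> \<bullet> (matrix_inv (mat \<theta> - T) *v exit_vector T)"

text \<open>
  The identity of rational functions is expressed at all real arguments where the resolvent exists
  (all but finitely many).
\<close>

definition minimal_me_rep :: "real ^ 'p \<Rightarrow> real ^ 'p ^ 'p \<Rightarrow> bool" where
  "minimal_me_rep \<alpha> T \<longleftrightarrow>
     (\<exists>P Q :: real poly. coprime P Q \<and> degree Q = CARD('p) \<and>
        (\<forall>\<theta>. invertible (mat \<theta> - T) \<longrightarrow> me_laplace \<alpha> T \<theta> = poly P \<theta> / poly Q \<theta>))"

context prob_space
begin

definition standard_brownian_motion :: "(real \<Rightarrow> 'a \<Rightarrow> real) \<Rightarrow> bool" where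
  "standard_brownian_motion B \<longleftrightarrow>
     (\<forall>t\<ge>0. random_variable borel (B t)) \<and>
     (AE w in M. B 0 w = 0) \<and>
     (AE w in M. continuous_on {0..} (\<lambda>t. B t w)) \<and>
     (\<forall>s t. 0 \<le> s \<and> s < t \<longrightarrow>
        distributed M lborel (\<lambda>w. B t w - B s w) (normal_density 0 (sqrt (t - s)))) \<and>
     (\<forall>(t :: nat \<Rightarrow> real) n. 0 \<le> t 0 \<and> mono t \<longrightarrow>
        indep_vars (\<lambda>_. borel) (\<lambda>i w. B (t (Suc i)) w - B (t i) w) {..<n})"

definition poisson_process :: "real \<Rightarrow> (real \<Rightarrow> 'a \<Rightarrow> nat) \<Rightarrow> bool" where
  "poisson_process rate N \<longleftrightarrow>
     (\<forall>t\<ge>0. random_variable (count_space UNIV) (N t)) \<and>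
     (AE w in M. N 0 w = 0) \<and>
     (AE w in M. mono_on {0..} (\<lambda>t. N t w) \<and>
        (\<forall>t\<ge>0. continuous (at_right t) (\<lambda>t. N t w))) \<and>
     (\<forall>s t. 0 \<le> s \<and> s < t \<longrightarrow>
        distr M (count_space UNIV) (\<lambda>w. N t w - N s w)
          = measure_pmf (poisson_pmf (rate * (t - s)))) \<and>
     (\<forall>(t :: nat \<Rightarrow> real) n. 0 \<le> t 0 \<and> mono t \<longrightarrow>
        indep_vars (\<lambda>_. count_space UNIV) (\<lambda>i w. N (t (Suc i)) w - N (t i) w) {..<n})"

definition process_sigma :: "'i set \<Rightarrow> 'b measure \<Rightarrow> ('i \<Rightarrow> 'a \<Rightarrow> 'b) \<Rightarrow> 'a set set" where
  "process_sigma I S Y =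
     sigma_sets (space M) (\<Union>i\<in>I. {Y i -` A \<inter> space M | A. A \<in> sets S})"

definition independent_drivers ::
  "(real \<Rightarrow> 'a \<Rightarrow> real) \<Rightarrow> (real \<Rightarrow> 'a \<Rightarrow> nat) \<Rightarrow> (nat \<Rightarrow> 'a \<Rightarrow> real) \<Rightarrow> bool" where
  "independent_drivers B N C \<longleftrightarrow>
     indep_sets ((!) [process_sigma {0..} borel B,
                      process_sigma {0..} (count_space UNIV) N,
                      process_sigma {1..} borel C]) {..<3}"

end

definition laplace_exponent :: "'w measure \<Rightarrow> (real \<Rightarrow> 'w \<Rightarrow> real) \<Rightarrow> real \<Rightarrow> real" where
  "laplace_exponent M X \<theta> = ln (LINT w|M. exp (\<theta> * X 1 w))"

definition largest_root :: "(real \<Rightarrow> real) \<Rightarrow> real \<Rightarrow> real" where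
  "largest_root \<psi> q = (GREATEST \<theta>. 0 \<le> \<theta> \<and> \<psi> \<theta> = q)"

text \<open>
  The derivative relative to \<open>{0..}\<close> is the right derivative at \<open>0\<close> and the ordinary one at
  positive arguments.
\<close>

definition laplace_exponent_deriv :: "(real \<Rightarrow> real) \<Rightarrow> real \<Rightarrow> real" where
  "laplace_exponent_deriv \<psi> \<theta> = vector_derivative \<psi> (at \<theta> within {0..})"

text \<open>
  As \<open>W\<close> is nonnegative, the gauge integral below coincides with the Lebesgue integral.
\<close>

definition scale_function :: "(real \<Rightarrow> real) \<Rightarrow> real \<Rightarrow> (real \<Rightarrow> real) \<Rightarrow> bool" where
  "scale_function \<psi> q W \<longleftrightarrow>
     (\<forall>x. W x \<ge> 0) \<and> (\<forall>x<0. W x = 0) \<and> continuous_on {0..} W \<and>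
     (\<forall>\<theta>>largest_root \<psi> q.
        ((\<lambda>x. exp (- \<theta> * x) * W x) has_integral (1 / (\<psi> \<theta> - q))) {0..})"

text \<open>
  Block vectors and matrices of size \<open>p + 1\<close> are indexed by \<open>'p option\<close>, with \<open>None\<close> as the first
  index.
\<close>

definition block_vec :: "real \<Rightarrow> real ^ 'p \<Rightarrow> real ^ 'p option" where
  "block_vec c v = (\<chi> i. case i of None \<Rightarrow> c | Some k \<Rightarrow> v $ k)"

definition block_mat ::
  "real \<Rightarrow> real ^ 'p \<Rightarrow> real ^ 'p \<Rightarrow> real ^ 'p ^ 'p \<Rightarrow> real ^ 'p option ^ 'p option" where
  "block_mat c r v A =
     (\<chi> i. case i of None \<Rightarrow> block_vec c r | Some k \<Rightarrow> block_vec (v $ k) (A $ k))"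

end

theory Submission
  imports Defs
begin

text \<open>
  Put \<open>\<kappa> = 2 \<lambda> / \<sigma>\<^sup>2\<close> and \<open>c\<^sub>n = \<omega> - a\<^sub>n\<close>.  Minimality gives controllability and observability, so the
  entries of \<open>e\<^sup>T\<^sup>x\<close> are combinations of shifts of the jump density and therefore integrable; hence
  \<open>(\<theta> I - T)\<^sup>-\<^sup>1\<close> is the Laplace transform of \<open>e\<^sup>T\<^sup>x\<close> for all \<open>\<theta> \<ge> 0\<close>.  Although \<open>\<alpha>\<close> and \<open>b\<^sub>n\<close> carry no signs,
  the functions \<open>b\<^sub>n e\<^sup>T\<^sup>x t\<close> of \<open>x \<ge> 0\<close> are nonnegative: the row vectors with this property form a cone that contains \<open>\<alpha>\<close> and is preserved by
  the resolvents at \<open>\<theta> \<ge> 0\<close>.  In the order of this cone the iteration increases.  Its fixed points are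
  \<open>c = \<eta> - \<rho>\<close>, \<open>b = \<kappa> \<alpha> (\<rho> I - T)\<^sup>-\<^sup>1\<close> with \<open>\<psi>(\<rho>) = q\<close>, because
  \<open>\<psi>(\<rho>) - q = \<sigma>\<^sup>2 / 2 ((\<rho> - \<eta>) (\<rho> + \<omega>) + \<kappa> \<alpha> (\<rho> I - T)\<^sup>-\<^sup>1 t)\<close>; the one with \<open>\<rho> = \<Phi>\<close> is an upper bound,
  so it is the limit and \<open>a = \<Phi> + 2 d / \<sigma>\<^sup>2\<close>.  Inverting the block matrix \<open>\<theta> I - G\<close> shows that the claimed formula
  for the scale function has Laplace transform \<open>1 / (\<psi>(\<theta>) - q)\<close> for large \<open>\<theta>\<close>, and a continuous
  function is determined by such values.
\<close>

section \<open>The matrix exponential\<close>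

lemma bounded_bilinear_matrix_mult:
  "bounded_bilinear ((**) :: real ^ 'n ^ 'm \<Rightarrow> real ^ 'p ^ 'n \<Rightarrow> real ^ 'p ^ 'm)"
  unfolding bilinear_conv_bounded_bilinear[symmetric] bilinear_def
  by (auto intro!: linearI simp: matrix_add_ldistrib matrix_scalar_ac
      simp flip: scalar_matrix_assoc)
    (simp add: matrix_matrix_mult_def vec_eq_iff sum.distrib algebra_simps)

lemma bounded_bilinear_matrix_vector:
  "bounded_bilinear ((*v) :: real ^ 'n ^ 'm \<Rightarrow> real ^ 'n \<Rightarrow> real ^ 'm)"
  unfolding bilinear_conv_bounded_bilinear[symmetric] bilinear_def
  by (auto intro!: linearI simp: algebra_simps scaleR_matrix_vector_assoc)

lemma bounded_linear_bilinear_form: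
  "bounded_linear (\<lambda>A :: real ^ 'n ^ 'm. u \<bullet> (A *v v))"
  by (intro bounded_linear_compose[OF bounded_linear_inner_right]
      bounded_bilinear.bounded_linear_left[OF bounded_bilinear_matrix_vector])

lemma bilinear_form_axis: "axis i 1 \<bullet> (A *v axis j 1) = (A :: real ^ 'n ^ 'm) $ i $ j"
  by (simp add: matrix_vector_mult_basis column_def inner_axis')

lemma matrix_power_commute:
  fixes A :: "real ^ 'n ^ 'n"
  shows "(((**) A) ^^ n) (mat 1) ** A = A ** (((**) A) ^^ n) (mat 1)"
  by (induction n) (simp_all flip: matrix_mul_assoc)

lemma matrix_power_scaleR:
  fixes A :: "real ^ 'n ^ 'n"
  shows "(((**) (x *\<^sub>R A)) ^^ n) (mat 1) = x ^ n *\<^sub>R (((**) A) ^^ n) (mat 1)"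
proof (induction n)
  case (Suc n)
  show ?case
    unfolding funpow.simps o_apply Suc
    by (simp add: matrix_scalar_ac scalar_matrix_assoc[symmetric])
qed simp

text \<open>Bounded bilinearity makes the norm submultiplicative up to a factor \<open>k\<close>,
  which is absorbed into the base \<open>norm A * k\<close> of the geometric bound.\<close>

lemma norm_matrix_power_bound:
  fixes A :: "real ^ 'n ^ 'n"
  obtains K c where "K \<ge> 0" "c \<ge> 0" "\<And>n. norm ((((**) A) ^^ n) (mat 1)) \<le> K * c ^ n"
proof -
  obtain k where k: "k > 0" "\<And>(A :: real ^ 'n ^ 'n) (B :: real ^ 'n ^ 'n). norm (A ** B) \<le> norm A * norm B * k"
    using bounded_bilinear.pos_bounded[OF bounded_bilinear_matrix_mult] by metis
  show ?thesis
  proof (rule that)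
    show "norm ((((**) A) ^^ n) (mat 1)) \<le> norm (mat 1 :: real ^ 'n ^ 'n) * (norm A * k) ^ n" for n
    proof (induction n)
      case (Suc n)
      have "norm ((((**) A) ^^ Suc n) (mat 1)) \<le> norm A * norm ((((**) A) ^^ n) (mat 1)) * k"
        unfolding funpow.simps o_apply using k(2)[of A "(((**) A) ^^ n) (mat 1)"] by blast
      also have "\<dots> \<le> norm A * (norm (mat 1 :: real ^ 'n ^ 'n) * (norm A * k) ^ n) * k"
        using Suc k(1) by (intro mult_right_mono mult_left_mono) auto
      finally show ?case by (simp add: ac_simps)
    qed simp
  qed (use k(1) in auto)
qed

text \<open>Both follow by comparison with the scalar exponential series. The second provides an
  exponential growth rate, hence Laplace transforms at all sufficiently large arguments.\<close>

lemma summable_matrix_exp: "summable (\<lambda>n. (((**) A) ^^ n) (mat 1) /\<^sub>R fact n :: real ^ 'n ^ 'n)"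
  and norm_mat_exp_bound: "\<exists>K c. 0 \<le> K \<and> 0 \<le> c \<and> (\<forall>x\<ge>0. norm (mat_exp (x *\<^sub>R A)) \<le> K * exp (c * x))"
proof -
  have *: "summable (\<lambda>n. norm ((((**) A) ^^ n) (mat 1) /\<^sub>R fact n))"
    for A :: "real ^ 'n ^ 'n"
  proof -
    obtain K c where Kc: "K \<ge> 0" "c \<ge> 0" "\<And>n. norm ((((**) A) ^^ n) (mat 1)) \<le> K * c ^ n"
      using norm_matrix_power_bound by blast
    show ?thesis
    proof (rule summable_comparison_test')
      show "summable (\<lambda>n. K * (c ^ n /\<^sub>R fact n))"
        by (intro summable_mult summable_exp_generic)
      show "norm (norm ((((**) A) ^^ n) (mat 1) /\<^sub>R fact n)) \<le> K * (c ^ n /\<^sub>R fact n)" for n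
        using mult_left_mono[OF Kc(3)[of n], of "inverse (fact n)"]
        by (simp add: ac_simps)
    qed
  qed
  show "summable (\<lambda>n. (((**) A) ^^ n) (mat 1) /\<^sub>R fact n)"
    by (rule summable_norm_cancel[OF *])
  obtain K c where Kc: "K \<ge> 0" "c \<ge> 0" "\<And>n. norm ((((**) A) ^^ n) (mat 1)) \<le> K * c ^ n"
    using norm_matrix_power_bound by blast
  have "norm (mat_exp (x *\<^sub>R A)) \<le> K * exp (c * x)" if "x \<ge> 0" for x
  proof -
    have "norm (mat_exp (x *\<^sub>R A)) \<le> (\<Sum>n. norm ((((**) (x *\<^sub>R A)) ^^ n) (mat 1) /\<^sub>R fact n))"
      unfolding mat_exp_def by (intro summable_norm *)
    also have "\<dots> \<le> (\<Sum>n. K * ((c * x) ^ n /\<^sub>R fact n))"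
    proof (intro suminf_le * summable_mult summable_exp_generic)
      show "norm ((((**) (x *\<^sub>R A)) ^^ n) (mat 1) /\<^sub>R fact n) \<le> K * ((c * x) ^ n /\<^sub>R fact n)" for n
        using mult_left_mono[OF Kc(3)[of n], of "inverse (fact n) * x ^ n"] that
        by (simp add: matrix_power_scaleR power_mult_distrib ac_simps)
    qed
    also have "\<dots> = K * exp (c * x)"
      unfolding exp_def by (intro suminf_mult summable_exp_generic)
    finally show ?thesis .
  qed
  with Kc show "\<exists>K c. 0 \<le> K \<and> 0 \<le> c \<and> (\<forall>x\<ge>0. norm (mat_exp (x *\<^sub>R A)) \<le> K * exp (c * x))"
    by blast
qed

lemma mat_exp_sums:
  fixes A :: "real ^ 'n ^ 'n"
  shows "(\<lambda>n. (x ^ n / fact n) *\<^sub>R (((**) A) ^^ n) (mat 1)) sums mat_exp (x *\<^sub>R A)"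
proof -
  have "(\<lambda>n. (((**) (x *\<^sub>R A)) ^^ n) (mat 1) /\<^sub>R fact n) sums mat_exp (x *\<^sub>R A)"
    unfolding mat_exp_def by (intro summable_sums summable_matrix_exp)
  then show ?thesis
    by (simp add: matrix_power_scaleR divide_inverse mult.commute)
qed

lemma mat_exp_0 [simp]: "mat_exp (0 :: real ^ 'n ^ 'n) = mat 1"
proof -
  have "(\<lambda>n. (((**) 0) ^^ n) (mat 1) /\<^sub>R fact n :: real ^ 'n ^ 'n) = (\<lambda>n. if n = 0 then mat 1 else 0)"
  proof
    show "(((**) 0) ^^ n) (mat 1) /\<^sub>R fact n = (if n = 0 then mat 1 else 0 :: real ^ 'n ^ 'n)" for n
      by (cases n) simp_all
  qed
  then show ?thesis
    unfolding mat_exp_def using sums_single[of 0 "\<lambda>_. mat 1 :: real ^ 'n ^ 'n"]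
    by (simp add: sums_iff)
qed

lemma mat_exp_commute:
  fixes A :: "real ^ 'n ^ 'n"
  shows "mat_exp (x *\<^sub>R A) ** A = A ** mat_exp (x *\<^sub>R A)"
proof -
  have 1: "(\<lambda>n. (x ^ n / fact n) *\<^sub>R (((**) A) ^^ n) (mat 1) ** A) sums (mat_exp (x *\<^sub>R A) ** A)"
    by (intro bounded_linear.sums[OF bounded_bilinear.bounded_linear_left[OF bounded_bilinear_matrix_mult]]
        mat_exp_sums)
  have 2: "(\<lambda>n. A ** ((x ^ n / fact n) *\<^sub>R (((**) A) ^^ n) (mat 1))) sums (A ** mat_exp (x *\<^sub>R A))"
    by (intro bounded_linear.sums[OF bounded_bilinear.bounded_linear_right[OF bounded_bilinear_matrix_mult]]
        mat_exp_sums)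
  have "(x ^ n / fact n) *\<^sub>R (((**) A) ^^ n) (mat 1) ** A = A ** ((x ^ n / fact n) *\<^sub>R (((**) A) ^^ n) (mat 1))" for n
    by (simp add: matrix_scalar_ac matrix_power_commute flip: scalar_matrix_assoc)
  with 1 2 show ?thesis by (simp add: sums_iff)
qed

text \<open>Tested against fixed \<open>u\<close> and \<open>v\<close>, the exponential is a real
  power series that converges everywhere, so termwise differentiation applies; the coefficient shift
  in \<open>diffs\<close> produces the extra factor \<open>A\<close>.\<close>

lemma bilinear_mat_exp_deriv:
  fixes A :: "real ^ 'n ^ 'n"
  shows "((\<lambda>x. u \<bullet> (mat_exp (x *\<^sub>R A) *v v)) has_real_derivative u \<bullet> (A ** mat_exp (x *\<^sub>R A) *v v)) (at x)"
proof -
  define c where "c n = u \<bullet> ((((**) A) ^^ n) (mat 1) *v v) / fact n" for n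
  have s: "(\<lambda>n. c n * x ^ n) sums (u \<bullet> (mat_exp (x *\<^sub>R A) *v v))" for x
    using bounded_linear.sums[OF bounded_linear_bilinear_form[of u v] mat_exp_sums[of x A]]
    by (simp add: c_def field_simps flip: scaleR_matrix_vector_assoc)
  have "(\<lambda>n. diffs c n * x ^ n) sums (u \<bullet> (A ** mat_exp (x *\<^sub>R A) *v v))" for x
  proof -
    have "(\<lambda>n. u \<bullet> ((A ** ((x ^ n / fact n) *\<^sub>R (((**) A) ^^ n) (mat 1))) *v v)) sums
        (u \<bullet> (A ** mat_exp (x *\<^sub>R A) *v v))"
      by (intro bounded_linear.sums[OF bounded_linear_bilinear_form]
        bounded_linear.sums[OF bounded_bilinear.bounded_linear_right[OF bounded_bilinear_matrix_mult]]
        mat_exp_sums)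
    moreover have "u \<bullet> ((A ** ((x ^ n / fact n) *\<^sub>R (((**) A) ^^ n) (mat 1))) *v v) = diffs c n * x ^ n" for n
      by (simp add: c_def diffs_def divide_simps matrix_scalar_ac
          flip: scaleR_matrix_vector_assoc scalar_matrix_assoc)
    ultimately show ?thesis by simp
  qed
  then have d: "(\<Sum>n. diffs c n * x ^ n) = u \<bullet> (A ** mat_exp (x *\<^sub>R A) *v v)"
    by (simp add: sums_iff)
  have "((\<lambda>x. \<Sum>n. c n * x ^ n) has_real_derivative (\<Sum>n. diffs c n * x ^ n)) (at x)"
    using s by (intro termdiffs_strong_converges_everywhere) (simp add: sums_iff)
  then show ?thesis
    unfolding d using s by (simp add: sums_iff)
qed

lemma mat_exp_deriv:
  "((\<lambda>x. mat_exp (x *\<^sub>R A)) has_vector_derivative A ** mat_exp (x *\<^sub>R A)) (at x)"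
proof -
  have *: "((\<lambda>x. mat_exp (x *\<^sub>R A) $ i $ j) has_vector_derivative (A ** mat_exp (x *\<^sub>R A)) $ i $ j) (at x)"
    for i j
    using bilinear_mat_exp_deriv[of "axis i 1" A "axis j 1" x]
    by (simp add: bilinear_form_axis has_real_derivative_iff_has_vector_derivative)
  then show ?thesis
    unfolding has_vector_derivative_def
    by (subst has_derivative_componentwise_within)
      (auto simp: Basis_vec_def inner_axis has_vector_derivative_def)
qed

lemma mat_exp_deriv':
  "((\<lambda>x. mat_exp ((x + y) *\<^sub>R A)) has_vector_derivative A ** mat_exp ((x + y) *\<^sub>R A)) (at x)"
proof -
  have "((\<lambda>x. x + y) has_vector_derivative 1) (at x)"
    by (auto intro!: derivative_eq_intros)
  from vector_diff_chain_at[OF this mat_exp_deriv] show ?thesis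
    by (simp add: o_def)
qed

lemma mat_exp_deriv_minus:
  "((\<lambda>x. mat_exp ((- x) *\<^sub>R A)) has_vector_derivative - (A ** mat_exp ((- x) *\<^sub>R A))) (at x)"
proof -
  have "(uminus has_vector_derivative - 1) (at x)"
    by (auto intro!: derivative_eq_intros)
  from vector_diff_chain_at[OF this mat_exp_deriv] show ?thesis
    by (simp add: o_def)
qed

text \<open>For fixed \<open>y\<close> the product of e^((x+y)A) and e^(-xA) has derivative zero in
  \<open>x\<close>, because \<open>A\<close> commutes with its exponential; the value at
  \<open>x = 0\<close> identifies the constant. The case \<open>y = 0\<close> gives the inverse,
  which turns this into the addition law.\<close>

lemma mat_exp_add: "mat_exp ((x + y) *\<^sub>R A) = mat_exp (x *\<^sub>R A) ** mat_exp (y *\<^sub>R A)"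
proof -
  have const: "mat_exp ((x + y) *\<^sub>R A) ** mat_exp ((- x) *\<^sub>R A) = mat_exp (y *\<^sub>R A)" for x y
  proof -
    have "((\<lambda>x. mat_exp ((x + y) *\<^sub>R A) ** mat_exp ((- x) *\<^sub>R A)) has_vector_derivative 0) (at x)" for x
    proof -
      have "((\<lambda>x. mat_exp ((x + y) *\<^sub>R A) ** mat_exp ((- x) *\<^sub>R A)) has_vector_derivative
         mat_exp ((x + y) *\<^sub>R A) ** (- (A ** mat_exp ((- x) *\<^sub>R A)))
         + (A ** mat_exp ((x + y) *\<^sub>R A)) ** mat_exp ((- x) *\<^sub>R A)) (at x)"
        by (rule bounded_bilinear.has_vector_derivative[OF bounded_bilinear_matrix_mult
              mat_exp_deriv' mat_exp_deriv_minus])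
      moreover have "mat_exp ((x + y) *\<^sub>R A) ** (- (A ** mat_exp ((- x) *\<^sub>R A))) =
          - ((A ** mat_exp ((x + y) *\<^sub>R A)) ** mat_exp ((- x) *\<^sub>R A))"
        unfolding bounded_bilinear.minus_right[OF bounded_bilinear_matrix_mult]
        by (simp only: matrix_mul_assoc mat_exp_commute)
      ultimately show ?thesis by simp
    qed
    then obtain c where c: "\<And>x. mat_exp ((x + y) *\<^sub>R A) ** mat_exp ((- x) *\<^sub>R A) = c"
      using has_vector_derivative_zero_constant[of UNIV "\<lambda>x. mat_exp ((x + y) *\<^sub>R A) ** mat_exp ((- x) *\<^sub>R A)"]
      by auto
    from c[of 0] c[of x] show ?thesis by simp
  qed
  have inv: "mat_exp ((- x) *\<^sub>R A) ** mat_exp (x *\<^sub>R A) = mat 1" for x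
    using const[of "- x" 0] by simp
  have "mat_exp ((y + x) *\<^sub>R A) = mat_exp ((y + x) *\<^sub>R A) ** (mat_exp ((- y) *\<^sub>R A) ** mat_exp (y *\<^sub>R A))"
    by (simp only: inv matrix_mul_rid)
  also have "\<dots> = mat_exp (x *\<^sub>R A) ** mat_exp (y *\<^sub>R A)"
    by (simp only: matrix_mul_assoc const)
  finally show ?thesis by (simp only: add.commute)
qed

section \<open>Resolvents as Laplace transforms\<close>

text \<open>Bridge from the gauge integral in \<open>scale_function\<close> to the Lebesgue
  integral: nonnegativity gives absolute integrability, and continuity gives the Borel measurability
  needed to pass from the completed measure to \<open>lborel\<close>.\<close>

lemma set_integrable_nonneg_has_integral:
  fixes f :: "real \<Rightarrow> real"
  assumes f: "(f has_integral I) S" and nonneg: "\<And>x. x \<in> S \<Longrightarrow> 0 \<le> f x"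
    and S: "S \<in> sets borel" and cont: "continuous_on S f"
  shows "set_integrable lborel S f" "(LINT x:S|lborel. f x) = I"
proof -
  have "f absolutely_integrable_on S"
    using f nonneg by (intro nonnegative_absolutely_integrable_1) (auto simp: integrable_on_def)
  moreover have "(\<lambda>x. indicator S x *\<^sub>R f x) \<in> borel_measurable lborel"
    using borel_measurable_continuous_on_indicator[OF S cont] by simp
  ultimately show int: "set_integrable lborel S f"
    unfolding set_integrable_def by (subst (asm) integrable_completion) auto
  from set_borel_integral_eq_integral(2)[OF int] f show "(LINT x:S|lborel. f x) = I"
    by (simp add: integral_unique)
qed

lemma set_integrable_exp_minus:
  "0 < a \<Longrightarrow> set_integrable lborel {0..} (\<lambda>x. exp (- a * x) :: real)"
  "0 < a \<Longrightarrow> (LINT x:{0..}|lborel. exp (- a * x)) = 1 / a"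
proof -
  have cont: "continuous_on {0..} (\<lambda>x. exp (- a * x) :: real)"
    by (intro continuous_intros)
  show "0 < a \<Longrightarrow> set_integrable lborel {0..} (\<lambda>x. exp (- a * x) :: real)"
    "0 < a \<Longrightarrow> (LINT x:{0..}|lborel. exp (- a * x)) = 1 / a"
    using set_integrable_nonneg_has_integral[OF has_integral_exp_minus_to_infinity[of a 0]] cont
    by auto
qed

text \<open>A nonzero limit would make a nonzero constant integrable on a half line, although its
  integrals over \<open>{c..x}\<close> grow linearly in \<open>x\<close>.\<close>

lemma set_integrable_tendsto_0:
  fixes g :: "real \<Rightarrow> real"
  assumes int: "set_integrable lborel {a..} g" and lim: "(g \<longlongrightarrow> l) at_top"
  shows "l = 0"
proof (rule ccontr)
  assume "l \<noteq> 0"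
  have "\<forall>\<^sub>F x in at_top. dist (g x) l < \<bar>l\<bar> / 2"
    using lim \<open>l \<noteq> 0\<close> by (intro tendstoD) auto
  then obtain b where b: "\<And>x. x \<ge> b \<Longrightarrow> dist (g x) l < \<bar>l\<bar> / 2"
    by (auto simp: eventually_at_top_linorder)
  define c where "c = max a b"
  have "set_integrable lborel {c..} g"
    by (rule set_integrable_subset[OF int]) (auto simp: c_def)
  then have "set_integrable lborel {c..} (\<lambda>_. \<bar>l\<bar> / 2)"
  proof (rule set_integrable_bound)
    show "AE x in lborel. x \<in> {c..} \<longrightarrow> norm (\<bar>l\<bar> / 2) \<le> norm (g x)"
      using b by (intro AE_I2) (fastforce simp: c_def dist_real_def abs_if split: if_splits)
  qed (simp add: set_borel_measurable_def)
  then have lim': "((\<lambda>x. LINT y:{c..x}|lborel. \<bar>l\<bar> / 2) \<longlongrightarrow> (LINT y:{c..}|lborel. \<bar>l\<bar> / 2)) at_top"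
    by (intro tendsto_set_lebesgue_integral_at_top) simp_all
  have "\<forall>\<^sub>F x in at_top. (LINT y:{c..x}|lborel. \<bar>l\<bar> / 2) = (x - c) * (\<bar>l\<bar> / 2)"
    using eventually_ge_at_top[of c]
    by eventually_elim (simp add: set_lebesgue_integral_def)
  from tendsto_cong[OF this] lim'
  have "((\<lambda>x. (x - c) * (\<bar>l\<bar> / 2)) \<longlongrightarrow> (LINT y:{c..}|lborel. \<bar>l\<bar> / 2)) at_top"
    by blast
  moreover have "filterlim (\<lambda>x. (x - c) * (\<bar>l\<bar> / 2)) at_top at_top"
    using \<open>l \<noteq> 0\<close> by real_asymp
  ultimately show False
    using not_tendsto_and_filterlim_at_infinity filterlim_at_top_imp_at_infinity
      trivial_limit_at_top_linorder by blast
qed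

lemma mat_scaled_mult: "mat (\<theta> :: real) *v x = \<theta> *\<^sub>R x"
proof -
  have "mat \<theta> = \<theta> *\<^sub>R (mat 1 :: real ^ 'a ^ 'a)"
    by (simp add: mat_def vec_eq_iff)
  then show ?thesis by (simp flip: scaleR_matrix_vector_assoc)
qed

lemma mat_exp_form_continuous:
  "continuous_on S (\<lambda>x. u \<bullet> (mat_exp (x *\<^sub>R A) *v v))"
  by (rule DERIV_continuous_on[OF has_field_derivative_at_within[OF bilinear_mat_exp_deriv]])

text \<open>Up to sign the integrand is the derivative of \<open>exp (- \<theta> * x) * (w \<bullet>
  (mat_exp (x *\<^sub>R A) *v v))\<close>. Convergence of the integral gives this function a limit
  at infinity, which is zero because the function is itself integrable. Letting
  \<open>mat \<theta> - A\<close> act on \<open>w\<close> avoids presupposing an inverse.\<close>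

lemma mat_exp_form_laplace_by_parts:
  fixes A :: "real ^ 'n ^ 'n"
  assumes int: "\<And>u v. set_integrable lborel {0..} (\<lambda>x. exp (- \<theta> * x) * (u \<bullet> (mat_exp (x *\<^sub>R A) *v v)))"
  shows "(LINT x:{0..}|lborel. exp (- \<theta> * x) * ((w v* (mat \<theta> - A)) \<bullet> (mat_exp (x *\<^sub>R A) *v v))) = w \<bullet> v"
proof -
  define g where "g x = exp (- \<theta> * x) * (w \<bullet> (mat_exp (x *\<^sub>R A) *v v))" for x
  define h where "h x = exp (- \<theta> * x) * ((w v* (mat \<theta> - A)) \<bullet> (mat_exp (x *\<^sub>R A) *v v))" for x
  have h_int: "set_integrable lborel {0..} h"
    unfolding h_def by (rule int)
  have deriv: "(g has_real_derivative - h x) (at x)" for x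
  proof -
    have "(g has_real_derivative exp (- \<theta> * x) * (w \<bullet> (A ** mat_exp (x *\<^sub>R A) *v v))
        + - \<theta> * exp (- \<theta> * x) * (w \<bullet> (mat_exp (x *\<^sub>R A) *v v))) (at x)"
      unfolding g_def by (auto intro!: derivative_eq_intros bilinear_mat_exp_deriv)
    moreover have "- h x = exp (- \<theta> * x) * (w \<bullet> (A ** mat_exp (x *\<^sub>R A) *v v))
        + - \<theta> * exp (- \<theta> * x) * (w \<bullet> (mat_exp (x *\<^sub>R A) *v v))"
      unfolding h_def dot_lmul_matrix matrix_vector_mult_diff_rdistrib mat_scaled_mult
      by (simp add: matrix_vector_mul_assoc inner_diff_right algebra_simps)
    ultimately show ?thesis by metis
  qed
  have cont: "continuous_on UNIV h"
    unfolding h_def by (intro continuous_intros mat_exp_form_continuous)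
  have FTC: "(LINT x:{0..b}|lborel. - h x) = g b - g 0" if "b \<ge> 0" for b
  proof -
    have "(LINT x|lborel. (- h x) * indicator {0..b} x) = g b - g 0"
      using that deriv continuous_on_interior[OF cont]
      by (intro integral_FTC_Icc_real continuous_minus) auto
    then show ?thesis
      by (simp add: set_lebesgue_integral_def mult.commute)
  qed
  have "((\<lambda>b. LINT x:{0..b}|lborel. - h x) \<longlongrightarrow> (LINT x:{0..}|lborel. - h x)) at_top"
    using h_int by (intro tendsto_set_lebesgue_integral_at_top) (simp_all add: set_integrable_def)
  moreover have "\<forall>\<^sub>F b in at_top. (LINT x:{0..b}|lborel. - h x) = g b - g 0"
    using eventually_ge_at_top[of 0] by eventually_elim (rule FTC)
  ultimately have lim: "((\<lambda>b. g b - g 0) \<longlongrightarrow> (LINT x:{0..}|lborel. - h x)) at_top"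
    using tendsto_cong by force
  then have "((\<lambda>b. g b - g 0 + g 0) \<longlongrightarrow> (LINT x:{0..}|lborel. - h x) + g 0) at_top"
    by (intro tendsto_intros)
  then have "(LINT x:{0..}|lborel. - h x) + g 0 = 0"
    using set_integrable_tendsto_0[of 0 g] int[of w v] unfolding g_def by simp
  moreover have "g 0 = w \<bullet> v"
    by (simp add: g_def)
  ultimately show ?thesis
    by (simp add: h_def set_lebesgue_integral_def)
qed

lemma matrix_inv_mult:
  assumes "invertible A"
  shows "A ** matrix_inv A = mat 1" "matrix_inv A ** A = mat 1"
  using someI_ex[of "\<lambda>A'. A ** A' = mat 1 \<and> A' ** A = mat 1"] assms
  by (auto simp: invertible_def matrix_inv_def)

text \<open>Integration by parts with \<open>v = w\<close> turns
  \<open>w v* (mat \<theta> - A) = 0\<close> into \<open>w \<bullet> w = 0\<close>, so convergence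
  of the integrals alone yields invertibility. Taking \<open>u\<close> times the inverse for
  \<open>w\<close> then gives the formula.\<close>

lemma resolvent_laplace:
  fixes A :: "real ^ 'n ^ 'n"
  assumes int: "\<And>u v. set_integrable lborel {0..} (\<lambda>x. exp (- \<theta> * x) * (u \<bullet> (mat_exp (x *\<^sub>R A) *v v)))"
  shows "invertible (mat \<theta> - A)"
    and "u \<bullet> (matrix_inv (mat \<theta> - A) *v v)
      = (LINT x:{0..}|lborel. exp (- \<theta> * x) * (u \<bullet> (mat_exp (x *\<^sub>R A) *v v)))"
proof -
  note parts = mat_exp_form_laplace_by_parts[OF int]
  have "w = 0" if "w v* (mat \<theta> - A) = 0" for w
    using parts[of w w] that by simp
  then have "\<exists>B. B ** transpose (mat \<theta> - A) = mat 1"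
    unfolding matrix_left_invertible_ker by simp
  then have "invertible (transpose (mat \<theta> - A))"
    using invertible_left_inverse by blast
  from transpose_invertible[OF this] show inv: "invertible (mat \<theta> - A)"
    by simp
  show "u \<bullet> (matrix_inv (mat \<theta> - A) *v v)
      = (LINT x:{0..}|lborel. exp (- \<theta> * x) * (u \<bullet> (mat_exp (x *\<^sub>R A) *v v)))"
    using parts[of "u v* matrix_inv (mat \<theta> - A)" v]
    by (simp add: vector_matrix_mul_assoc matrix_inv_mult[OF inv] flip: dot_lmul_matrix)
qed

lemma mat_exp_form_bound:
  fixes A :: "real ^ 'n ^ 'n"
  shows "\<exists>K c. 0 \<le> K \<and> 0 \<le> c \<and>
    (\<forall>x\<ge>0. \<forall>u v. \<bar>u \<bullet> (mat_exp (x *\<^sub>R A) *v v)\<bar> \<le> K * exp (c * x) * norm u * norm v)"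
proof -
  obtain K c where Kc: "0 \<le> K" "0 \<le> c" "\<And>x. x \<ge> 0 \<Longrightarrow> norm (mat_exp (x *\<^sub>R A)) \<le> K * exp (c * x)"
    using norm_mat_exp_bound by metis
  obtain k where k: "k > 0" "\<And>(B :: real ^ 'n ^ 'n) v. norm (B *v v) \<le> norm B * norm v * k"
    using bounded_bilinear.pos_bounded[OF bounded_bilinear_matrix_vector] by metis
  have "\<bar>u \<bullet> (mat_exp (x *\<^sub>R A) *v v)\<bar> \<le> (K * k) * exp (c * x) * norm u * norm v" if "x \<ge> 0" for x u v
  proof -
    have "\<bar>u \<bullet> (mat_exp (x *\<^sub>R A) *v v)\<bar> \<le> norm u * norm (mat_exp (x *\<^sub>R A) *v v)"
      by (rule Cauchy_Schwarz_ineq2)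
    also have "\<dots> \<le> norm u * ((K * exp (c * x)) * norm v * k)"
      using Kc(3)[OF that] k(1)
      by (intro mult_left_mono order.trans[OF k(2)] mult_right_mono) auto
    finally show ?thesis by (simp add: ac_simps)
  qed
  with Kc k show ?thesis by (intro exI[of _ "K * k"] exI[of _ c]) auto
qed

lemma set_integrable_mat_exp_form:
  fixes A :: "real ^ 'n ^ 'n"
  shows "\<exists>c\<ge>0. \<forall>\<theta>>c. \<forall>u v. set_integrable lborel {0..} (\<lambda>x. exp (- \<theta> * x) * (u \<bullet> (mat_exp (x *\<^sub>R A) *v v)))"
proof -
  obtain K c where Kc: "0 \<le> K" "0 \<le> c"
    "\<And>x u v. x \<ge> 0 \<Longrightarrow> \<bar>u \<bullet> (mat_exp (x *\<^sub>R A) *v v)\<bar> \<le> K * exp (c * x) * norm u * norm v"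
    using mat_exp_form_bound by metis
  have "set_integrable lborel {0..} (\<lambda>x. exp (- \<theta> * x) * (u \<bullet> (mat_exp (x *\<^sub>R A) *v v)))"
    if "\<theta> > c" for \<theta> u v
  proof (rule set_integrable_bound)
    show "set_integrable lborel {0..} (\<lambda>x. K * norm u * norm v * exp (- (\<theta> - c) * x))"
      using that by (intro set_integrable_mult_right set_integrable_exp_minus) auto
    have "norm (exp (- \<theta> * x) * (u \<bullet> (mat_exp (x *\<^sub>R A) *v v)))
         \<le> norm (K * norm u * norm v * exp (- (\<theta> - c) * x))" if "x \<ge> 0" for x
      using mult_left_mono[OF Kc(3)[OF that, of u v], of "exp (- \<theta> * x)"] Kc(1)
      by (simp add: abs_mult algebra_simps flip: exp_add)
    then show "AE x in lborel. x \<in> {0..} \<longrightarrow> norm (exp (- \<theta> * x) * (u \<bullet> (mat_exp (x *\<^sub>R A) *v v)))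
         \<le> norm (K * norm u * norm v * exp (- (\<theta> - c) * x))"
      by (intro AE_I2) auto
    show "set_borel_measurable lborel {0..} (\<lambda>x. exp (- \<theta> * x) * (u \<bullet> (mat_exp (x *\<^sub>R A) *v v)))"
      unfolding set_borel_measurable_def
      by (subst measurable_lborel2, intro borel_measurable_continuous_on_indicator)
        (auto intro!: continuous_intros mat_exp_form_continuous)
  qed
  with Kc show ?thesis by blast
qed

section \<open>Minimal representations\<close>

text \<open>Serves to extend a linear property from a family of vectors with trivial orthogonal
  complement to the whole space.\<close>

lemma subspace_eq_UNIV:
  fixes S :: "'a :: euclidean_space set"
  assumes "subspace S" and "\<And>w. \<forall>y\<in>S. w \<bullet> y = 0 \<Longrightarrow> w = 0"
  shows "S = UNIV"
proof -
  have "S\<^sup>\<bottom> = {0}"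
    using assms(2) by (auto simp: orthogonal_comp_def orthogonal_def inner_commute)
  then show ?thesis
    using orthogonal_comp_self[OF assms(1)] by simp
qed

text \<open>The resolvent set contains a half line. Having infinitely many points is what turns
  identities of values into identities of polynomials.\<close>

lemma infinite_resolvent_set:
  fixes T :: "real ^ 'n ^ 'n"
  shows "infinite {\<theta>. invertible (mat \<theta> - T)}"
proof -
  obtain c where "\<forall>\<theta>>c. \<forall>u v. set_integrable lborel {0..} (\<lambda>x. exp (- \<theta> * x) * (u \<bullet> (mat_exp (x *\<^sub>R T) *v v)))"
    using set_integrable_mat_exp_form by blast
  then have "{c<..} \<subseteq> {\<theta>. invertible (mat \<theta> - T)}"
    by (auto intro!: resolvent_laplace(1))
  then show ?thesis
    using infinite_Ioi infinite_super by blast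
qed

text \<open>Iterates \<open>\<theta> R y = y + R (T y)\<close> for the resolvent \<open>R\<close>;
  the terms split off on the way collect in the polynomial \<open>N\<close>.\<close>

lemma resolvent_power:
  fixes T :: "real ^ 'n ^ 'n" and \<alpha> v :: "real ^ 'n"
  shows "\<exists>N. \<forall>\<theta>. invertible (mat \<theta> - T) \<longrightarrow>
    \<theta> ^ k * (\<alpha> \<bullet> (matrix_inv (mat \<theta> - T) *v v)) =
      poly N \<theta> + \<alpha> \<bullet> (matrix_inv (mat \<theta> - T) *v ((((**) T) ^^ k) (mat 1) *v v))"
proof (induction k)
  case 0
  then show ?case by (intro exI[of _ 0]) simp
next
  case (Suc k)
  then obtain N where N: "\<And>\<theta>. invertible (mat \<theta> - T) \<Longrightarrow>
    \<theta> ^ k * (\<alpha> \<bullet> (matrix_inv (mat \<theta> - T) *v v)) =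
      poly N \<theta> + \<alpha> \<bullet> (matrix_inv (mat \<theta> - T) *v ((((**) T) ^^ k) (mat 1) *v v))"
    by blast
  define y where "y = (((**) T) ^^ k) (mat 1) *v v"
  show ?case
  proof (intro exI[of _ "[:0, 1:] * N + [:\<alpha> \<bullet> y:]"] allI impI)
    fix \<theta> assume inv: "invertible (mat \<theta> - T)"
    define R where "R = matrix_inv (mat \<theta> - T)"
    have "R *v ((mat \<theta> - T) *v y) = y"
      by (simp add: R_def matrix_vector_mul_assoc matrix_inv_mult[OF inv])
    then have "\<theta> *\<^sub>R (R *v y) = y + R *v (T *v y)"
      by (simp add: matrix_vector_mult_diff_rdistrib matrix_vector_mult_diff_distrib
          mat_scaled_mult matrix_vector_mult_scaleR algebra_simps)
    then have "\<theta> * (\<alpha> \<bullet> (R *v y)) = \<alpha> \<bullet> y + \<alpha> \<bullet> (R *v (T *v y))"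
      by (metis inner_add_right inner_scaleR_right)
    moreover have "(((**) T) ^^ Suc k) (mat 1) *v v = T *v y"
      by (simp add: y_def matrix_vector_mul_assoc)
    ultimately show "\<theta> ^ Suc k * (\<alpha> \<bullet> (matrix_inv (mat \<theta> - T) *v v)) =
        poly ([:0, 1:] * N + [:\<alpha> \<bullet> y:]) \<theta> +
        \<alpha> \<bullet> (matrix_inv (mat \<theta> - T) *v ((((**) T) ^^ Suc k) (mat 1) *v v))"
      using N[OF inv] by (simp add: R_def y_def algebra_simps)
  qed
qed

text \<open>An element \<open>r\<close> of least degree generates the ideal of \<open>P\<close> and
  \<open>Q\<close>. Coprimality makes \<open>r\<close> a unit, so 1 is a combination of
  \<open>P\<close> and \<open>Q\<close>, and \<open>q\<close> times this combination is divisible by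
  \<open>Q\<close>.\<close>

lemma coprime_poly_dvd_mult:
  fixes P Q q :: "'a :: field poly"
  assumes cop: "coprime P Q" and dvd: "Q dvd q * P"
  shows "Q dvd q"
proof -
  define I where "I = {a * P + b * Q | a b. True}"
  have I_lin: "c * x - e * y \<in> I" if xy: "x \<in> I" "y \<in> I" for c e x y
  proof -
    obtain a b a' b' where "x = a * P + b * Q" "y = a' * P + b' * Q"
      using xy by (auto simp: I_def)
    then have "c * x - e * y = (c * a - e * a') * P + (c * b - e * b') * Q"
      by (simp add: algebra_simps)
    then show ?thesis by (auto simp: I_def)
  qed
  have PQ: "P \<in> I" "Q \<in> I"
    unfolding I_def by (auto intro: exI[of _ 0] exI[of _ 1])
  have "P \<noteq> 0 \<or> Q \<noteq> 0"
    using cop by auto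
  then have "\<exists>r. r \<in> I \<and> r \<noteq> 0"
    using PQ by blast
  then obtain r where r: "r \<in> I" "r \<noteq> 0" "\<And>x. x \<in> I \<Longrightarrow> x \<noteq> 0 \<Longrightarrow> degree r \<le> degree x"
    using exists_least_iff[of "\<lambda>n. \<exists>r\<in>I. r \<noteq> 0 \<and> degree r = n"] by (metis not_le)
  have r_dvd: "r dvd x" if "x \<in> I" for x
  proof -
    have "x mod r \<in> I"
      using I_lin[OF that r(1), of 1 "x div r"] by (simp add: minus_div_mult_eq_mod)
    then have "x mod r = 0"
      using r(3)[of "x mod r"] degree_mod_less[OF r(2), of x] by (metis not_le)
    then show ?thesis by (simp add: mod_eq_0_iff_dvd)
  qed
  then have "r dvd 1"
    using PQ cop by (meson coprime_common_divisor)
  then obtain u where u: "1 = r * u" ..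
  obtain a b where ab: "r = a * P + b * Q"
    using r(1) by (auto simp: I_def)
  have "q = q * (r * u)"
    by (simp flip: u)
  also have "\<dots> = u * a * (q * P) + u * b * q * Q"
    by (simp add: ab algebra_simps)
  also have "Q dvd \<dots>"
    by (intro dvd_add dvd_mult dvd dvd_refl)
  finally show ?thesis .
qed

text \<open>
  A vector orthogonal to all \<open>T\<^sup>k v\<close> makes \<open>v, T v, \<dots>, T\<^sup>p\<^sup>-\<^sup>1 v\<close> linearly dependent, so \<open>q(T) v = 0\<close> for
  some nonzero \<open>q\<close> of degree less than \<open>p\<close>; then \<open>q\<close> is a denominator of the rational function.
\<close>

lemma minimal_controllable:
  fixes T :: "real ^ 'n ^ 'n" and \<alpha> v w :: "real ^ 'n"
  assumes cop: "coprime P Q" and deg: "degree Q = CARD('n)"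
    and rat: "\<And>\<theta>. invertible (mat \<theta> - T) \<Longrightarrow>
      \<alpha> \<bullet> (matrix_inv (mat \<theta> - T) *v v) = poly P \<theta> / poly Q \<theta>"
    and orth: "\<And>k. w \<bullet> ((((**) T) ^^ k) (mat 1) *v v) = 0"
  shows "w = 0"
proof (rule ccontr)
  assume "w \<noteq> 0"
  define y where "y k = (((**) T) ^^ k) (mat 1) *v v" for k
  \<comment> \<open>Numbering the index type makes the first \<open>CARD('n)\<close> vectors
    \<open>y k\<close> the columns of a square matrix.\<close>
  obtain f :: "'n \<Rightarrow> nat" where f: "bij_betw f UNIV {0..<CARD('n)}"
    using ex_bij_betw_finite_nat[of "UNIV :: 'n set"] by auto
  define Y where "Y = transpose (\<chi> j. y (f j))"
  have Y: "Y *v x = (\<Sum>j\<in>UNIV. x $ j *\<^sub>R y (f j))" for x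
    by (simp add: Y_def matrix_vector_column scalar_mult_eq_scaleR)
  \<comment> \<open>\<open>w\<close> is a nonzero left null vector of \<open>Y\<close>; a right null
    vector \<open>x\<close> supplies the coefficients of the annihilating polynomial
    \<open>q\<close>.\<close>
  have "w v* Y = 0"
    using orth by (simp add: Y_def vector_matrix_mult_def vec_eq_iff transpose_def y_def inner_vec_def)
  then have "\<not> invertible Y"
    using \<open>w \<noteq> 0\<close> by (metis matrix_inv_mult(1) vector_matrix_mul_assoc vector_matrix_mul_rid vector_matrix_mult_0)
  then obtain x where x: "x \<noteq> 0" "Y *v x = 0"
    using matrix_left_invertible_ker[of Y] invertible_left_inverse[of Y] by blast
  define q where "q = (\<Sum>j\<in>UNIV. monom (x $ j) (f j))"
  have f_inj: "f i = f j \<longleftrightarrow> i = j" for i j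
    using f by (auto simp: bij_betw_def inj_def)
  have f_less: "f j < CARD('n)" for j
    using f by (auto simp: bij_betw_def)
  have "coeff q (f j) = x $ j" for j
    by (simp add: q_def coeff_sum f_inj)
  with x(1) have "q \<noteq> 0"
    by (metis coeff_0 vec_eq_iff zero_index)
  have "degree q < CARD('n)"
    unfolding q_def by (intro degree_sum_less) (auto intro: le_less_trans[OF degree_monom_le f_less])
  obtain N where N: "\<And>k \<theta>. invertible (mat \<theta> - T) \<Longrightarrow>
    \<theta> ^ k * (\<alpha> \<bullet> (matrix_inv (mat \<theta> - T) *v v)) =
      poly (N k) \<theta> + \<alpha> \<bullet> (matrix_inv (mat \<theta> - T) *v y k)"
    using resolvent_power[where T = T and \<alpha> = \<alpha> and v = v] unfolding y_def by metis
  \<comment> \<open>\<open>N'\<close> gathers the polynomial parts; the remaining resolvent terms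
    add up to one resolvent applied to \<open>Y *v x = 0\<close>.\<close>
  define N' where "N' = (\<Sum>j\<in>UNIV. smult (x $ j) (N (f j)))"
  have eq: "poly q \<theta> * (\<alpha> \<bullet> (matrix_inv (mat \<theta> - T) *v v)) = poly N' \<theta>"
    if "invertible (mat \<theta> - T)" for \<theta>
  proof -
    have "poly q \<theta> * (\<alpha> \<bullet> (matrix_inv (mat \<theta> - T) *v v)) =
       (\<Sum>j\<in>UNIV. x $ j * (\<theta> ^ f j * (\<alpha> \<bullet> (matrix_inv (mat \<theta> - T) *v v))))"
      by (simp add: q_def poly_sum poly_monom sum_distrib_right mult.assoc)
    also have "\<dots> = poly N' \<theta> + (\<Sum>j\<in>UNIV. x $ j * (\<alpha> \<bullet> (matrix_inv (mat \<theta> - T) *v y (f j))))"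
      by (simp add: N[OF that] N'_def poly_sum sum.distrib algebra_simps)
    also have "(\<Sum>j\<in>UNIV. x $ j * (\<alpha> \<bullet> (matrix_inv (mat \<theta> - T) *v y (f j)))) =
        \<alpha> \<bullet> (matrix_inv (mat \<theta> - T) *v (Y *v x))"
      by (simp add: Y linear_sum[OF matrix_vector_mul_linear] inner_sum_right matrix_vector_mult_scaleR)
    also have "\<dots> = 0"
      by (simp add: x(2))
    finally show ?thesis by simp
  qed
  \<comment> \<open>\<open>q * P\<close> and \<open>N' * Q\<close> agree at infinitely many points,
    hence as polynomials; then \<open>Q\<close> divides \<open>q\<close>, against the
    degrees.\<close>
  have "poly (q * P - N' * Q) \<theta> = 0" if "invertible (mat \<theta> - T)" "poly Q \<theta> \<noteq> 0" for \<theta>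
    using eq[OF that(1)] rat[OF that(1)] that(2) by (simp add: field_simps)
  then have "{\<theta>. invertible (mat \<theta> - T)} - {\<theta>. poly Q \<theta> = 0} \<subseteq> {\<theta>. poly (q * P - N' * Q) \<theta> = 0}"
    by auto
  moreover have "Q \<noteq> 0"
    using deg by auto
  then have "infinite ({\<theta>. invertible (mat \<theta> - T)} - {\<theta>. poly Q \<theta> = 0})"
    by (intro Diff_infinite_finite poly_roots_finite infinite_resolvent_set)
  ultimately have "q * P - N' * Q = 0"
    using poly_roots_finite finite_subset by blast
  then have "Q dvd q * P"
    by simp
  then have "Q dvd q"
    by (rule coprime_poly_dvd_mult[OF cop])
  then have "degree Q \<le> degree q"
    using \<open>q \<noteq> 0\<close> by (rule dvd_imp_degree_le)
  with \<open>degree q < CARD('n)\<close> deg show False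
    by simp
qed

text \<open>Differentiating \<open>k\<close> times puts the \<open>k\<close>-th power of
  \<open>T\<close> in front of the exponential; letting \<open>x\<close> tend to 0 then removes the
  exponential.\<close>

lemma mat_exp_controllable:
  fixes T :: "real ^ 'n ^ 'n" and v w :: "real ^ 'n"
  assumes "\<And>x. x \<ge> 0 \<Longrightarrow> w \<bullet> (mat_exp (x *\<^sub>R T) *v v) = 0"
  shows "w \<bullet> ((((**) T) ^^ k) (mat 1) *v v) = 0"
proof -
  \<comment> \<open>Only positive \<open>x\<close> at first: there the function vanishes in a
    neighbourhood, so its two-sided derivative is zero.\<close>
  have pos: "w \<bullet> ((((**) T) ^^ k) (mat 1) ** mat_exp (x *\<^sub>R T) *v v) = 0" if "x > 0" for x
    using that
  proof (induction k arbitrary: x)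
    case (Suc k)
    define u where "u = w v* (((**) T) ^^ k) (mat 1)"
    have u: "u \<bullet> (mat_exp (x *\<^sub>R T) *v v) = 0" if "x > 0" for x
      using Suc.IH[OF that] by (simp add: u_def dot_lmul_matrix matrix_vector_mul_assoc)
    have "((\<lambda>x. u \<bullet> (mat_exp (x *\<^sub>R T) *v v)) has_real_derivative 0) (at x)"
      using Suc.prems u
      by (auto intro: has_field_derivative_transform_within_open[OF DERIV_const[of 0], where S = "{0<..}"])
    then have "u \<bullet> (T ** mat_exp (x *\<^sub>R T) *v v) = 0"
      using bilinear_mat_exp_deriv DERIV_unique by blast
    moreover have "(((**) T) ^^ k) (mat 1) ** (T ** mat_exp (x *\<^sub>R T)) =
        (((**) T) ^^ Suc k) (mat 1) ** mat_exp (x *\<^sub>R T)"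
      by (simp add: matrix_mul_assoc matrix_power_commute)
    ultimately show ?case
      unfolding u_def dot_lmul_matrix matrix_vector_mul_assoc by (simp only:)
  qed (use assms in simp)
  define u where "u = w v* (((**) T) ^^ k) (mat 1)"
  have "u \<bullet> (mat_exp (x *\<^sub>R T) *v v) = 0" if "x > 0" for x
    using pos[OF that] by (simp add: u_def dot_lmul_matrix matrix_vector_mul_assoc)
  then have "u \<bullet> (mat_exp (0 *\<^sub>R T) *v v) = 0"
    using continuous_constant_on_closure[where S = "{0<..}" and x = 0 and a = 0,
        OF mat_exp_form_continuous[of _ u T v]] by simp
  then show ?thesis
    by (simp add: u_def dot_lmul_matrix)
qed

lemma matrix_inv_unique:
  fixes A B :: "real ^ 'n ^ 'n"
  assumes "A ** B = mat 1"
  shows "matrix_inv A = B"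
proof -
  have inv: "invertible A"
    using assms invertible_right_inverse by blast
  have "matrix_inv A = matrix_inv A ** (A ** B)"
    by (simp add: assms)
  also have "\<dots> = B"
    by (simp only: matrix_mul_assoc matrix_inv_mult[OF inv] matrix_mul_lid)
  finally show ?thesis .
qed

lemma matrix_inv_transpose:
  fixes A :: "real ^ 'n ^ 'n"
  assumes "invertible A"
  shows "matrix_inv (transpose A) = transpose (matrix_inv A)"
  by (rule matrix_inv_unique) (simp add: matrix_inv_mult[OF assms] flip: matrix_transpose_mul)

lemma matrix_power_transpose:
  fixes A :: "real ^ 'n ^ 'n"
  shows "(((**) (transpose A)) ^^ k) (mat 1) = transpose ((((**) A) ^^ k) (mat 1))"
  by (induction k) (simp_all add: matrix_power_commute flip: matrix_transpose_mul)

lemma minimal_me_rep_controllable: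
  assumes min: "minimal_me_rep \<alpha> T"
    and orth: "\<And>x. x \<ge> 0 \<Longrightarrow> w \<bullet> (mat_exp (x *\<^sub>R T) *v exit_vector T) = 0"
  shows "w = 0"
proof -
  obtain P Q where PQ: "coprime P Q" "degree Q = CARD('a)"
    "\<And>\<theta>. invertible (mat \<theta> - T) \<Longrightarrow> \<alpha> \<bullet> (matrix_inv (mat \<theta> - T) *v exit_vector T) = poly P \<theta> / poly Q \<theta>"
    using min unfolding minimal_me_rep_def me_laplace_def by metis
  show ?thesis
    by (rule minimal_controllable[OF PQ mat_exp_controllable[OF orth]])
qed

text \<open>Observability is controllability of the transposed system with \<open>\<alpha>\<close>
  and the exit vector exchanged; a scalar equals its transpose, so the rational function is
  unchanged.\<close>

lemma minimal_me_rep_observable: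
  assumes min: "minimal_me_rep \<alpha> T"
    and orth: "\<And>x. x \<ge> 0 \<Longrightarrow> \<alpha> \<bullet> (mat_exp (x *\<^sub>R T) *v w) = 0"
  shows "w = 0"
proof -
  obtain P Q where PQ: "coprime P Q" "degree Q = CARD('a)"
    "\<And>\<theta>. invertible (mat \<theta> - T) \<Longrightarrow> \<alpha> \<bullet> (matrix_inv (mat \<theta> - T) *v exit_vector T) = poly P \<theta> / poly Q \<theta>"
    using min unfolding minimal_me_rep_def me_laplace_def by metis
  have transpose_diff: "mat \<theta> - transpose T = transpose (mat \<theta> - T)" for \<theta>
    by (simp add: transpose_def mat_def vec_eq_iff eq_commute)
  show ?thesis
  proof (rule minimal_controllable[OF PQ(1,2)])
    show "exit_vector T \<bullet> (matrix_inv (mat \<theta> - transpose T) *v \<alpha>) = poly P \<theta> / poly Q \<theta>"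
      if "invertible (mat \<theta> - transpose T)" for \<theta>
    proof -
      have inv: "invertible (mat \<theta> - T)"
        using transpose_invertible[OF that] unfolding transpose_diff by simp
      then show ?thesis
        using PQ(3)[OF inv] unfolding transpose_diff matrix_inv_transpose[OF inv]
        by (simp add: inner_commute[of "exit_vector T"] dot_lmul_matrix)
    qed
    show "w \<bullet> ((((**) (transpose T)) ^^ k) (mat 1) *v \<alpha>) = 0" for k
      using mat_exp_controllable[OF orth, of k]
      by (simp add: matrix_power_transpose inner_commute[of w] dot_lmul_matrix)
  qed
qed

lemma set_integrable_Ici_shift:
  fixes f :: "real \<Rightarrow> real"
  assumes f: "set_integrable lborel {0..} f" and "s \<ge> 0"
  shows "set_integrable lborel {0..} (\<lambda>x. f (s + x))"
proof -
  have "set_integrable lborel {s..} f"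
    using f by (rule set_integrable_subset) (use \<open>s \<ge> 0\<close> in auto)
  then have "integrable lborel (\<lambda>x. indicator {s..} x *\<^sub>R f x)"
    by (simp add: set_integrable_def)
  from lborel_integrable_real_affine[OF this, of 1 s] show ?thesis
    by (simp add: set_integrable_def indicator_def)
qed

section \<open>Resolvents and positivity for a minimal matrix-exponential density\<close>

locale minimal_me =
  fixes \<alpha> :: "real ^ 'p" and T :: "real ^ 'p ^ 'p"
  assumes minimal: "minimal_me_rep \<alpha> T"
    and density_nonneg: "\<And>x. 0 \<le> me_density \<alpha> T x"
    and density_integral: "(\<integral>\<^sup>+x. ennreal (me_density \<alpha> T x) \<partial>lborel) = 1"
    and density_measurable: "me_density \<alpha> T \<in> borel_measurable lborel"
begin

abbreviation E :: "real \<Rightarrow> real ^ 'p ^ 'p" where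
  "E x \<equiv> mat_exp (x *\<^sub>R T)"

abbreviation t :: "real ^ 'p" where
  "t \<equiv> exit_vector T"

abbreviation R :: "real \<Rightarrow> real ^ 'p ^ 'p" where
  "R \<theta> \<equiv> matrix_inv (mat \<theta> - T)"

lemma density_integrable: "integrable lborel (me_density \<alpha> T)"
  using density_measurable density_nonneg density_integral by (intro integrableI_nonneg) auto

lemma set_integrable_density: "set_integrable lborel {0..} (\<lambda>x. \<alpha> \<bullet> (E x *v t))"
  unfolding set_integrable_def
proof (rule integrable_cong_AE_imp[OF density_integrable])
  show "(\<lambda>x. indicator {0..} x *\<^sub>R (\<alpha> \<bullet> (E x *v t))) \<in> borel_measurable lborel"
    by (subst measurable_lborel2, intro borel_measurable_continuous_on_indicator mat_exp_form_continuous) auto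
  show "AE x in lborel. me_density \<alpha> T x = indicator {0..} x *\<^sub>R (\<alpha> \<bullet> (E x *v t))"
    using AE_lborel_singleton[of 0]
    by eventually_elim (auto simp: me_density_def split: split_indicator)
qed

text \<open>
  By controllability and observability each entry of \<open>E x\<close> is a linear combination of shifts
  \<open>f (s + x + r)\<close> of the density \<open>f\<close>, hence integrable; no spectral theory of \<open>T\<close> is needed.
\<close>

lemma form_integrable: "set_integrable lborel {0..} (\<lambda>x. u \<bullet> (E x *v v))"
proof -
  have zero: "set_integrable lborel {0..} (\<lambda>x :: real. 0 :: real)"
    by (simp add: set_integrable_def)
  \<comment> \<open>The column is freed first: \<open>S\<close> contains every
    \<open>E r *v t\<close>, and by controllability nothing nonzero is orthogonal to all of
    these.\<close>
  define S where "S = {v. \<forall>s\<ge>0. set_integrable lborel {0..} (\<lambda>x. \<alpha> \<bullet> (E s *v (E x *v v)))}"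
  have "S = UNIV"
  proof (rule subspace_eq_UNIV)
    show "subspace S"
      by (auto simp: subspace_def S_def matrix_vector_right_distrib inner_add_right
          matrix_vector_mult_scaleR zero)
    have *: "E r *v t \<in> S" if "r \<ge> 0" for r
    proof -
      have "set_integrable lborel {0..} (\<lambda>x. \<alpha> \<bullet> (E s *v (E x *v (E r *v t))))" if "s \<ge> 0" for s
      proof -
        have "\<alpha> \<bullet> (E s *v (E x *v (E r *v t))) = \<alpha> \<bullet> (E (s + r + x) *v t)" for x
        proof -
          have "E s ** (E x ** E r) = E (s + r + x)"
            by (simp flip: mat_exp_add add: add_ac)
          then show ?thesis by (simp add: matrix_vector_mul_assoc matrix_mul_assoc)
        qed
        then show ?thesis
          using set_integrable_Ici_shift[OF set_integrable_density, of "s + r"] that \<open>r \<ge> 0\<close> by simp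
      qed
      then show ?thesis by (simp add: S_def)
    qed
    show "w = 0" if "\<forall>y\<in>S. w \<bullet> y = 0" for w
      using that * by (intro minimal_me_rep_controllable[OF minimal]) auto
  qed
  then have v: "set_integrable lborel {0..} (\<lambda>x. \<alpha> \<bullet> (E s *v (E x *v v)))" if "s \<ge> 0" for v s
    using that by (auto simp: S_def)
  \<comment> \<open>Then the row: \<open>S'\<close> contains every \<open>\<alpha> v* E s\<close>,
    and observability takes the place of controllability.\<close>
  define S' where "S' = {u. \<forall>v. set_integrable lborel {0..} (\<lambda>x. u \<bullet> (E x *v v))}"
  have "S' = UNIV"
  proof (rule subspace_eq_UNIV)
    show "subspace S'"
      by (auto simp: subspace_def S'_def inner_add_left zero)
    have "\<alpha> v* E s \<in> S'" if "s \<ge> 0" for s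
      using v[OF that] by (simp add: S'_def dot_lmul_matrix)
    then have "\<alpha> \<bullet> (E x *v w) = 0" if "\<forall>y\<in>S'. w \<bullet> y = 0" "x \<ge> 0" for w x
      using that by (simp flip: dot_lmul_matrix add: inner_commute[of _ w])
    then show "w = 0" if "\<forall>y\<in>S'. w \<bullet> y = 0" for w
      using that by (intro minimal_me_rep_observable[OF minimal])
  qed
  then show ?thesis
    by (auto simp: S'_def)
qed

lemma laplace_form_integrable:
  assumes "\<theta> \<ge> 0"
  shows "set_integrable lborel {0..} (\<lambda>x. exp (- \<theta> * x) * (u \<bullet> (E x *v v)))"
proof (rule set_integrable_bound[OF form_integrable[of u v]])
  show "set_borel_measurable lborel {0..} (\<lambda>x. exp (- \<theta> * x) * (u \<bullet> (E x *v v)))"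
    unfolding set_borel_measurable_def
    by (subst measurable_lborel2, intro borel_measurable_continuous_on_indicator)
      (auto intro!: continuous_intros mat_exp_form_continuous)
  show "AE x in lborel. x \<in> {0..} \<longrightarrow> norm (exp (- \<theta> * x) * (u \<bullet> (E x *v v))) \<le> norm (u \<bullet> (E x *v v))"
    using assms by (intro AE_I2) (auto simp: abs_mult intro!: mult_left_le_one_le)
qed

lemma resolvent_invertible: "\<theta> \<ge> 0 \<Longrightarrow> invertible (mat \<theta> - T)"
  by (rule resolvent_laplace(1)[OF laplace_form_integrable])

lemma resolvent_form:
  "\<theta> \<ge> 0 \<Longrightarrow> u \<bullet> (R \<theta> *v v) = (LINT x:{0..}|lborel. exp (- \<theta> * x) * (u \<bullet> (E x *v v)))"
  by (rule resolvent_laplace(2)[OF laplace_form_integrable])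

text \<open>Uniformity in \<open>\<theta>\<close> is the point: together with the resolvent identity
  it gives continuity on the closed half line, 0 included.\<close>

lemma resolvent_bound:
  assumes "\<theta> \<ge> 0"
  shows "\<bar>u \<bullet> (R \<theta> *v v)\<bar> \<le> (LINT x:{0..}|lborel. \<bar>u \<bullet> (E x *v v)\<bar>)"
proof -
  have "\<bar>u \<bullet> (R \<theta> *v v)\<bar> \<le> (LINT x:{0..}|lborel. norm (exp (- \<theta> * x) * (u \<bullet> (E x *v v))))"
    unfolding resolvent_form[OF assms] real_norm_def[symmetric]
    by (rule set_integral_norm_bound[OF laplace_form_integrable[OF assms]])
  also have "\<dots> \<le> (LINT x:{0..}|lborel. \<bar>u \<bullet> (E x *v v)\<bar>)"
    using assms form_integrable[of u v]
    by (intro set_integral_mono set_integrable_norm laplace_form_integrable)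
      (auto simp: abs_mult set_integrable_abs intro!: mult_left_le_one_le)
  finally show ?thesis .
qed

lemma resolvent_identity:
  assumes "\<theta> \<ge> 0" "\<phi> \<ge> 0"
  shows "R \<theta> *v v - R \<phi> *v v = (\<phi> - \<theta>) *\<^sub>R (R \<theta> *v (R \<phi> *v v))"
proof -
  note inv = assms[THEN resolvent_invertible]
  have "(\<phi> - \<theta>) *\<^sub>R (R \<phi> *v v) = (mat \<phi> - T) *v (R \<phi> *v v) - (mat \<theta> - T) *v (R \<phi> *v v)"
    by (simp add: matrix_vector_mult_diff_rdistrib mat_scaled_mult algebra_simps)
  also have "\<dots> = v - (mat \<theta> - T) *v (R \<phi> *v v)"
    by (simp add: matrix_vector_mul_assoc matrix_inv_mult[OF inv(2)])
  finally have "R \<theta> *v ((\<phi> - \<theta>) *\<^sub>R (R \<phi> *v v)) = R \<theta> *v v - R \<theta> *v ((mat \<theta> - T) *v (R \<phi> *v v))"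
    by (simp add: matrix_vector_mult_diff_distrib)
  also have "R \<theta> *v ((mat \<theta> - T) *v (R \<phi> *v v)) = R \<phi> *v v"
    by (simp only: matrix_vector_mul_assoc matrix_inv_mult[OF inv(1)] matrix_vector_mul_lid matrix_mul_assoc matrix_mul_lid)
  finally show ?thesis
    by (simp add: matrix_vector_mult_scaleR)
qed

lemma resolvent_tendsto:
  assumes "\<phi> \<ge> 0"
  shows "((\<lambda>\<theta>. u \<bullet> (R \<theta> *v v)) \<longlongrightarrow> u \<bullet> (R \<phi> *v v)) (at \<phi> within {0..})"
proof -
  define B where "B = (LINT x:{0..}|lborel. \<bar>u \<bullet> (E x *v (R \<phi> *v v))\<bar>)"
  have "((\<lambda>\<theta>. u \<bullet> (R \<theta> *v v) - u \<bullet> (R \<phi> *v v)) \<longlongrightarrow> 0) (at \<phi> within {0..})"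
  proof (rule Lim_null_comparison)
    have "norm (u \<bullet> (R \<theta> *v v) - u \<bullet> (R \<phi> *v v)) \<le> \<bar>\<phi> - \<theta>\<bar> * B" if "\<theta> \<ge> 0" for \<theta>
      using resolvent_bound[OF that, of u "R \<phi> *v v"]
      by (simp add: resolvent_identity[OF that assms] abs_mult B_def mult_left_mono flip: inner_diff_right)
    then show "\<forall>\<^sub>F \<theta> in at \<phi> within {0..}. norm (u \<bullet> (R \<theta> *v v) - u \<bullet> (R \<phi> *v v)) \<le> \<bar>\<phi> - \<theta>\<bar> * B"
      by (auto simp: eventually_at_filter)
    have "((\<lambda>\<theta>. \<bar>\<phi> - \<theta>\<bar> * B) \<longlongrightarrow> \<bar>\<phi> - \<phi>\<bar> * B) (at \<phi> within {0..})"
      by (intro tendsto_intros)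
    then show "((\<lambda>\<theta>. \<bar>\<phi> - \<theta>\<bar> * B) \<longlongrightarrow> 0) (at \<phi> within {0..})"
      by simp
  qed
  then show ?thesis
    by (simp add: LIM_zero_iff)
qed

text \<open>By the resolvent identity the difference quotient equals
  \<open>- (\<alpha> \<bullet> (R \<theta> *v (R \<phi> *v t)))\<close>, so continuity of the
  resolvent suffices. At \<open>\<phi> = 0\<close> this is the right derivative.\<close>

lemma me_laplace_deriv:
  assumes "\<phi> \<ge> 0"
  shows "(me_laplace \<alpha> T has_real_derivative - (\<alpha> \<bullet> (R \<phi> *v (R \<phi> *v t)))) (at \<phi> within {0..})"
  unfolding has_field_derivative_iff
proof (rule Lim_transform_eventually)
  show "((\<lambda>\<theta>. - (\<alpha> \<bullet> (R \<theta> *v (R \<phi> *v t)))) \<longlongrightarrow> - (\<alpha> \<bullet> (R \<phi> *v (R \<phi> *v t)))) (at \<phi> within {0..})"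
    by (intro tendsto_minus resolvent_tendsto assms)
  have "- (\<alpha> \<bullet> (R \<theta> *v (R \<phi> *v t))) = (me_laplace \<alpha> T \<theta> - me_laplace \<alpha> T \<phi>) / (\<theta> - \<phi>)"
    if "\<theta> \<ge> 0" "\<theta> \<noteq> \<phi>" for \<theta>
  proof -
    have "me_laplace \<alpha> T \<theta> - me_laplace \<alpha> T \<phi> = (\<phi> - \<theta>) * (\<alpha> \<bullet> (R \<theta> *v (R \<phi> *v t)))"
      by (simp add: me_laplace_def resolvent_identity[OF that(1) assms] flip: inner_diff_right)
    with that(2) show ?thesis by (simp add: field_simps)
  qed
  then show "\<forall>\<^sub>F \<theta> in at \<phi> within {0..}. - (\<alpha> \<bullet> (R \<theta> *v (R \<phi> *v t))) =
      (me_laplace \<alpha> T \<theta> - me_laplace \<alpha> T \<phi>) / (\<theta> - \<phi>)"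
    by (auto simp: eventually_at_filter)
qed

text \<open>Plays the part of the nonnegative orthant: positivity is asked of functions of
  \<open>x\<close>, not of the entries of \<open>u\<close>.\<close>

definition cone :: "(real ^ 'p) set" where
  "cone = {u. \<forall>x\<ge>0. 0 \<le> u \<bullet> (E x *v t)}"

lemma \<alpha>_in_cone: "\<alpha> \<in> cone"
proof -
  \<comment> \<open>\<open>me_density\<close> is set to 0 at \<open>x = 0\<close>, so nonnegativity
    of the form at that point comes from continuity.\<close>
  have pos: "0 \<le> \<alpha> \<bullet> (E x *v t)" if "x > 0" for x
    using density_nonneg[of x] that by (simp add: me_density_def)
  have "0 \<le> \<alpha> \<bullet> (E x *v t)" if "x \<ge> 0" for x
    using that pos
      continuous_ge_on_closure[where S = "{0<..}" and x = x and a = 0,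
        OF mat_exp_form_continuous[of _ \<alpha> T t]] by simp
  then show ?thesis
    by (simp add: cone_def)
qed

text \<open>By the semigroup law, u R(\<theta>) e^(Tx) t is the Laplace integral over y of u
  e^(T(y+x)) t, whose integrand is nonnegative for \<open>u\<close> in the cone.\<close>

lemma cone_resolvent:
  assumes "u \<in> cone" "\<theta> \<ge> 0"
  shows "u v* R \<theta> \<in> cone"
proof -
  have "0 \<le> (u v* R \<theta>) \<bullet> (E x *v t)" if "x \<ge> 0" for x
  proof -
    have "(u v* R \<theta>) \<bullet> (E x *v t) = (LINT y:{0..}|lborel. exp (- \<theta> * y) * (u \<bullet> (E y *v (E x *v t))))"
      by (simp only: dot_lmul_matrix resolvent_form[OF assms(2)])
    also have "\<dots> \<ge> 0"
      unfolding set_lebesgue_integral_def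
    proof (rule Bochner_Integration.integral_nonneg)
      show "0 \<le> indicator {0..} y *\<^sub>R (exp (- \<theta> * y) * (u \<bullet> (E y *v (E x *v t))))" for y
        using assms(1) that
        by (auto simp: cone_def matrix_vector_mul_assoc split: split_indicator simp flip: mat_exp_add)
    qed
    finally show ?thesis .
  qed
  then show ?thesis by (simp add: cone_def)
qed

lemma cone_add: "u \<in> cone \<Longrightarrow> v \<in> cone \<Longrightarrow> u + v \<in> cone"
  by (simp add: cone_def inner_add_left)

lemma cone_scaleR: "u \<in> cone \<Longrightarrow> 0 \<le> c \<Longrightarrow> c *\<^sub>R u \<in> cone"
  by (simp add: cone_def)

lemma cone_inner_nonneg: "u \<in> cone \<Longrightarrow> 0 \<le> u \<bullet> t"
  unfolding cone_def by (auto dest!: spec[of _ 0])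

text \<open>Expectations under \<open>distributed\<close> arrive as nonnegative extended integrals.
  The integrand agrees with that of \<open>resolvent_form\<close> off the null set
  \<open>{0}\<close>.\<close>

lemma me_laplace_nn_integral:
  assumes "\<theta> \<ge> 0"
  shows "(\<integral>\<^sup>+x. ennreal (me_density \<alpha> T x) * ennreal (exp (- \<theta> * x)) \<partial>lborel) = ennreal (me_laplace \<alpha> T \<theta>)"
proof -
  define g where "g x = indicator {0..} x *\<^sub>R (exp (- \<theta> * x) * (\<alpha> \<bullet> (E x *v t)))" for x
  have int: "integrable lborel g"
    using laplace_form_integrable[OF assms, of \<alpha> t] unfolding set_integrable_def g_def .
  have ae: "AE x in lborel. g x = me_density \<alpha> T x * exp (- \<theta> * x)"
    using AE_lborel_singleton[of 0]
    by eventually_elim (auto simp: me_density_def g_def split: split_indicator)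
  have "(\<integral>\<^sup>+x. ennreal (me_density \<alpha> T x) * ennreal (exp (- \<theta> * x)) \<partial>lborel) = (\<integral>\<^sup>+x. ennreal (g x) \<partial>lborel)"
    using ae by (intro nn_integral_cong_AE, eventually_elim) (simp add: ennreal_mult density_nonneg)
  also have "\<dots> = ennreal (LINT x|lborel. g x)"
    using int ae by (intro nn_integral_eq_integral) (auto simp: density_nonneg elim!: eventually_mono)
  also have "(LINT x|lborel. g x) = (LINT x:{0..}|lborel. exp (- \<theta> * x) * (\<alpha> \<bullet> (E x *v t)))"
    by (simp add: g_def set_lebesgue_integral_def)
  finally show ?thesis
    by (simp add: me_laplace_def resolvent_form[OF assms])
qed

end

section \<open>Convergence of the iteration\<close>

lemma vec_mat_scaled: "u v* mat (\<theta> :: real) = \<theta> *\<^sub>R u"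
  using mat_scaled_mult[of \<theta> u] transpose_matrix_vector[of "mat \<theta>" u] by simp

context minimal_me
begin

lemma vec_resolvent_mult: "\<theta> \<ge> 0 \<Longrightarrow> (u v* R \<theta>) v* (mat \<theta> - T) = u"
  by (simp add: vector_matrix_mul_assoc matrix_inv_mult resolvent_invertible)

lemma vec_resolvent_unique:
  assumes "\<theta> \<ge> 0" "u v* (mat \<theta> - T) = w"
  shows "u = w v* R \<theta>"
  unfolding assms(2)[symmetric]
  by (simp add: vector_matrix_mul_assoc matrix_inv_mult resolvent_invertible assms(1))

text \<open>\<open>mat \<eta> - T\<close> is \<open>mat \<phi> - T\<close> plus
  \<open>mat (\<eta> - \<phi>)\<close>. With \<open>u = \<kappa> *\<^sub>R \<alpha>\<close> this
  makes \<open>u v* R \<phi>\<close> a fixed point of the recursion for \<open>b\<close> at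
  \<open>c = \<eta> - \<phi>\<close>.\<close>

lemma resolvent_fixed_point:
  assumes "\<phi> \<ge> 0" "\<eta> \<ge> 0"
  shows "u v* R \<phi> = (u + (\<eta> - \<phi>) *\<^sub>R (u v* R \<phi>)) v* R \<eta>"
proof (rule vec_resolvent_unique[OF assms(2)])
  have "u v* R \<phi> v* (mat \<eta> - T) = u v* R \<phi> v* (mat \<phi> - T) + (\<eta> - \<phi>) *\<^sub>R (u v* R \<phi>)"
    by (simp add: vec_mat_scaled algebra_simps)
  then show "u v* R \<phi> v* (mat \<eta> - T) = u + (\<eta> - \<phi>) *\<^sub>R (u v* R \<phi>)"
    by (simp add: vec_resolvent_mult[OF assms(1)])
qed

text \<open>Tested against \<open>E x *v t\<close> the sequence is increasing and bounded;
  controllability extends convergence to all test vectors, in particular to the coordinates.\<close>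

lemma convergent_in_cone_order:
  assumes mono: "\<And>n. b (Suc n) - b n \<in> cone" and bdd: "\<And>n. u - b n \<in> cone"
  shows "convergent b"
proof -
  define S where "S = {w. convergent (\<lambda>n. b n \<bullet> w)}"
  have "E x *v t \<in> S" if "x \<ge> 0" for x
  proof -
    have "incseq (\<lambda>n. b n \<bullet> (E x *v t))"
      using mono that by (intro incseq_SucI) (auto simp: cone_def inner_diff_left)
    moreover have "\<And>n. b n \<bullet> (E x *v t) \<le> u \<bullet> (E x *v t)"
      using bdd that by (auto simp: cone_def inner_diff_left)
    ultimately show ?thesis
      unfolding S_def convergent_def using incseq_convergent by blast
  qed
  moreover have "subspace S"
    by (auto simp: subspace_def S_def inner_add_right convergent_const intro: convergent_add convergent_mult)
  ultimately have "S = UNIV"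
    by (intro subspace_eq_UNIV) (auto intro!: minimal_me_rep_controllable[OF minimal])
  then have "convergent (\<lambda>n. b n $ i)" for i
    using inner_axis[of _ i 1] by (auto simp: S_def inner_axis dest!: arg_cong[where f = "\<lambda>S. axis i 1 \<in> S"])
  then obtain l where "\<And>i. (\<lambda>n. b n $ i) \<longlonglongrightarrow> l i"
    unfolding convergent_def by metis
  then have "b \<longlonglongrightarrow> (\<chi> i. l i)"
    by (intro vec_tendstoI) simp
  then show ?thesis
    by (auto simp: convergent_def)
qed

text \<open>
  With \<open>c = \<omega> - a\<close> the recursion is monotone for the order of the cone, and the fixed point belonging
  to the largest root \<open>\<Phi>\<close> bounds it.  The limit is a fixed point belonging to some root \<open>\<rho> \<ge> \<Phi>\<close>, so
  \<open>\<rho> = \<Phi>\<close>.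
\<close>

lemma iteration_converges:
  assumes \<omega>: "\<omega> > 0" and \<eta>: "\<eta> > 0" and \<kappa>: "\<kappa> \<ge> 0"
    and c0: "c 0 = 0" and b0: "b 0 = 0"
    and b_Suc: "\<And>n. b (Suc n) = (\<kappa> *\<^sub>R \<alpha> + c n *\<^sub>R b n) v* R \<eta>"
    and c_Suc: "\<And>n. c (Suc n) = ((c n)\<^sup>2 + b (Suc n) \<bullet> t) / (\<omega> + \<eta>)"
    and \<Phi>: "0 \<le> \<Phi>" "\<Phi> \<le> \<eta>"
    and root: "(\<Phi> - \<eta>) * (\<Phi> + \<omega>) + \<kappa> * me_laplace \<alpha> T \<Phi> = 0"
    and largest: "\<And>\<theta>. \<theta> > \<Phi> \<Longrightarrow> (\<theta> - \<eta>) * (\<theta> + \<omega>) + \<kappa> * me_laplace \<alpha> T \<theta> \<noteq> 0"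
  shows "c \<longlonglongrightarrow> \<eta> - \<Phi>" "b \<longlonglongrightarrow> (\<kappa> *\<^sub>R \<alpha>) v* R \<Phi>"
proof -
  define c' where "c' = \<eta> - \<Phi>"
  define b' where "b' = (\<kappa> *\<^sub>R \<alpha>) v* R \<Phi>"
  have c'_nonneg: "c' \<ge> 0"
    using \<Phi> by (simp add: c'_def)
  have b'_fix: "b' = (\<kappa> *\<^sub>R \<alpha> + c' *\<^sub>R b') v* R \<eta>"
    unfolding b'_def c'_def using \<Phi> \<eta> by (intro resolvent_fixed_point) auto
  have b't: "b' \<bullet> t = \<kappa> * me_laplace \<alpha> T \<Phi>"
    by (simp add: b'_def dot_lmul_matrix me_laplace_def)
  \<comment> \<open>Multiplied out, this is the root equation with
    \<open>\<Phi> = \<eta> - c'\<close>.\<close>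
  have c'_fix: "c' = (c'\<^sup>2 + b' \<bullet> t) / (\<omega> + \<eta>)"
    using root \<omega> \<eta> by (simp add: b't c'_def field_simps power2_eq_square)
  have inv: "0 \<le> c n \<and> b n \<in> cone \<and> c n \<le> c' \<and> b' - b n \<in> cone" for n
  proof (induction n)
    case 0
    have "b' \<in> cone"
      unfolding b'_def using \<kappa> \<Phi> by (intro cone_resolvent cone_scaleR \<alpha>_in_cone)
    then show ?case
      using c'_nonneg by (simp add: c0 b0 cone_def)
  next
    case (Suc n)
    have 1: "b (Suc n) \<in> cone"
      unfolding b_Suc using Suc \<kappa> \<eta> by (intro cone_resolvent cone_add cone_scaleR \<alpha>_in_cone) auto
    \<comment> \<open>The difference of the products \<open>c' b'\<close> and \<open>c n b n\<close>
      is split so that every coefficient is nonnegative and every vector lies in the cone.\<close>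
    have "b' - b (Suc n) = (c' *\<^sub>R (b' - b n) + (c' - c n) *\<^sub>R b n) v* R \<eta>"
      by (subst b'_fix) (simp add: b_Suc algebra_simps flip: vector_matrix_mult_diff_distrib)
    also have "\<dots> \<in> cone"
      using Suc c'_nonneg \<eta> by (intro cone_resolvent cone_add cone_scaleR) auto
    finally have 2: "b' - b (Suc n) \<in> cone" .
    have 3: "0 \<le> c (Suc n)"
      using cone_inner_nonneg[OF 1] \<omega> \<eta> by (simp add: c_Suc)
    have "(c n)\<^sup>2 \<le> c'\<^sup>2"
      using Suc by (intro power_mono) auto
    moreover have "b (Suc n) \<bullet> t \<le> b' \<bullet> t"
      using cone_inner_nonneg[OF 2] by (simp add: inner_diff_left)
    ultimately have "c (Suc n) \<le> c'"
      using \<omega> \<eta> by (subst c'_fix) (simp add: c_Suc divide_right_mono)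
    with 1 2 3 show ?case by blast
  qed
  have mono: "c n \<le> c (Suc n) \<and> b (Suc n) - b n \<in> cone" for n
  proof (induction n)
    case 0
    then show ?case using inv[of 1] by (simp add: c0 b0)
  next
    case (Suc n)
    have "b (Suc (Suc n)) - b (Suc n) =
        ((\<kappa> *\<^sub>R \<alpha> + c (Suc n) *\<^sub>R b (Suc n)) - (\<kappa> *\<^sub>R \<alpha> + c n *\<^sub>R b n)) v* R \<eta>"
      by (simp only: b_Suc[of "Suc n"] vector_matrix_mult_diff_distrib b_Suc[of n, symmetric])
    also have "\<dots> = (c (Suc n) *\<^sub>R (b (Suc n) - b n) + (c (Suc n) - c n) *\<^sub>R b n) v* R \<eta>"
      by (rule arg_cong[where f = "\<lambda>u. u v* R \<eta>"]) (simp add: algebra_simps)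
    also have "\<dots> \<in> cone"
      using Suc inv[of n] inv[of "Suc n"] \<eta> by (intro cone_resolvent cone_add cone_scaleR) auto
    finally have 1: "b (Suc (Suc n)) - b (Suc n) \<in> cone" .
    have "(c n)\<^sup>2 \<le> (c (Suc n))\<^sup>2"
      using Suc inv[of n] by (intro power_mono) auto
    moreover have "b (Suc n) \<bullet> t \<le> b (Suc (Suc n)) \<bullet> t"
      using cone_inner_nonneg[OF 1] by (simp add: inner_diff_left)
    ultimately have "((c n)\<^sup>2 + b (Suc n) \<bullet> t) / (\<omega> + \<eta>) \<le> ((c (Suc n))\<^sup>2 + b (Suc (Suc n)) \<bullet> t) / (\<omega> + \<eta>)"
      using \<omega> \<eta> by (intro divide_right_mono add_mono) auto
    with 1 show ?case by (simp only: c_Suc)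
  qed
  obtain cl where cl: "c \<longlonglongrightarrow> cl"
    using incseq_convergent[of c c'] mono inv by (meson incseq_SucI)
  have "convergent b"
    using mono inv by (intro convergent_in_cone_order[of b b']) auto
  then obtain bl where bl: "b \<longlonglongrightarrow> bl"
    by (auto simp: convergent_def)
  define \<rho> where "\<rho> = \<eta> - cl"
  have "cl \<le> c'"
    using inv by (intro LIMSEQ_le_const2[OF cl]) auto
  then have "\<rho> \<ge> \<Phi>"
    by (simp add: \<rho>_def c'_def)
  have lin: "bounded_linear (\<lambda>u. u v* R \<eta>)"
    using bounded_bilinear.bounded_linear_right[OF bounded_bilinear_matrix_vector, of "transpose (R \<eta>)"] by simp
  have "(\<lambda>n. b (Suc n)) \<longlonglongrightarrow> (\<kappa> *\<^sub>R \<alpha> + cl *\<^sub>R bl) v* R \<eta>"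
    unfolding b_Suc by (intro bounded_linear.tendsto[OF lin] tendsto_intros cl bl)
  with LIMSEQ_Suc[OF bl] have bl_fix: "bl = (\<kappa> *\<^sub>R \<alpha> + cl *\<^sub>R bl) v* R \<eta>"
    using LIMSEQ_unique by blast
  have "(\<lambda>n. c (Suc n)) \<longlonglongrightarrow> (cl\<^sup>2 + bl \<bullet> t) / (\<omega> + \<eta>)"
    unfolding c_Suc using \<omega> \<eta> by (intro tendsto_intros cl LIMSEQ_Suc[OF bl]) auto
  with LIMSEQ_Suc[OF cl] have cl_fix: "cl = (cl\<^sup>2 + bl \<bullet> t) / (\<omega> + \<eta>)"
    using LIMSEQ_unique by blast
  \<comment> \<open>Undoing the resolvent at \<open>\<eta>\<close> and moving
    \<open>cl *\<^sub>R bl\<close> to the left exhibits \<open>bl\<close> as a resolvent vector at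
    \<open>\<rho>\<close>; the scalar fixed-point equation then says that \<open>\<rho>\<close> is a
    root.\<close>
  have "bl v* (mat \<eta> - T) = \<kappa> *\<^sub>R \<alpha> + cl *\<^sub>R bl"
    using \<eta> by (subst bl_fix) (simp add: vec_resolvent_mult)
  then have "bl v* (mat \<rho> - T) = \<kappa> *\<^sub>R \<alpha>"
    by (simp add: vec_mat_scaled \<rho>_def algebra_simps)
  then have bl_eq: "bl = (\<kappa> *\<^sub>R \<alpha>) v* R \<rho>"
    using \<Phi> \<open>\<rho> \<ge> \<Phi>\<close> by (intro vec_resolvent_unique) auto
  then have "bl \<bullet> t = \<kappa> * me_laplace \<alpha> T \<rho>"
    by (simp add: dot_lmul_matrix me_laplace_def)
  with cl_fix have "(\<rho> - \<eta>) * (\<rho> + \<omega>) + \<kappa> * me_laplace \<alpha> T \<rho> = 0"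
    using \<omega> \<eta> by (simp add: \<rho>_def field_simps power2_eq_square)
  with largest[of \<rho>] \<open>\<rho> \<ge> \<Phi>\<close> have "\<rho> = \<Phi>"
    by linarith
  with cl bl show "c \<longlonglongrightarrow> \<eta> - \<Phi>" "b \<longlonglongrightarrow> (\<kappa> *\<^sub>R \<alpha>) v* R \<Phi>"
    by (auto simp: bl_eq \<rho>_def)
qed

end

section \<open>Uniqueness of Laplace transforms\<close>

text \<open>In the variable u = e^(-x) the transforms at \<open>\<theta>0 + 1 + n\<close> are
  moments, and all of them vanish. By Weierstrass approximation the integral against a tent around
  \<open>x0\<close> vanishes too, which is impossible for a continuous function that is nonzero at
  \<open>x0\<close>.\<close>

lemma laplace_transform_zero:
  fixes h :: "real \<Rightarrow> real"
  assumes cont: "continuous_on {0..} h"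
    and int: "\<And>\<theta>. \<theta> > \<theta>0 \<Longrightarrow> set_integrable lborel {0..} (\<lambda>x. exp (- \<theta> * x) * h x)"
    and zero: "\<And>\<theta>. \<theta> > \<theta>0 \<Longrightarrow> (LINT x:{0..}|lborel. exp (- \<theta> * x) * h x) = 0"
    and "x0 \<ge> 0"
  shows "h x0 = 0"
proof (rule ccontr)
  assume "h x0 \<noteq> 0"
  \<comment> \<open>The shift by 1 makes \<open>k\<close> itself integrable and keeps every argument
    used above \<open>\<theta>0\<close>.\<close>
  define k where "k x = exp (- (\<theta>0 + 1) * x) * h x" for x
  have k_cont: "continuous_on {0..} k"
    unfolding k_def by (intro continuous_intros cont)
  have k_int: "set_integrable lborel {0..} k"
    unfolding k_def by (rule int) simp
  have kn: "exp (- x) ^ n * k x = exp (- (\<theta>0 + 1 + real n) * x) * h x" for n x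
    by (simp add: k_def algebra_simps flip: exp_of_nat_mult exp_add)
  have kn_int: "set_integrable lborel {0..} (\<lambda>x. exp (- x) ^ n * k x)" for n
    unfolding kn by (rule int) simp
  have kn_zero: "(LINT x:{0..}|lborel. exp (- x) ^ n * k x) = 0" for n
    unfolding kn by (rule zero) simp
  have poly: "set_integrable lborel {0..} (\<lambda>x. p (exp (- x)) * k x)"
      "(LINT x:{0..}|lborel. p (exp (- x)) * k x) = 0"
    if p_poly: "real_polynomial_function p" for p
  proof -
    obtain a n where p: "p = (\<lambda>x. \<Sum>i\<le>n. a i * x ^ i)"
      using p_poly unfolding real_polynomial_function_iff_sum by blast
    have eq: "indicator {0..} x *\<^sub>R (p (exp (- x)) * k x) =
        (\<Sum>i\<le>n. a i * (indicator {0..} x *\<^sub>R (exp (- x) ^ i * k x)))" for x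
      by (simp add: p sum_distrib_left sum_distrib_right mult_ac)
    show "set_integrable lborel {0..} (\<lambda>x. p (exp (- x)) * k x)"
      unfolding set_integrable_def eq
      using kn_int[unfolded set_integrable_def]
      by (intro Bochner_Integration.integrable_sum integrable_mult_right) auto
    show "(LINT x:{0..}|lborel. p (exp (- x)) * k x) = 0"
      unfolding set_lebesgue_integral_def eq
      using kn_int[unfolded set_integrable_def] kn_zero[unfolded set_lebesgue_integral_def]
      by (subst Bochner_Integration.integral_sum) (auto intro!: integrable_mult_right)
  qed
  have "k x0 \<noteq> 0"
    using \<open>h x0 \<noteq> 0\<close> by (simp add: k_def)
  then obtain \<delta> where \<delta>: "\<delta> > 0" "\<And>x. x \<ge> 0 \<Longrightarrow> dist x x0 < \<delta> \<Longrightarrow> dist (k x) (k x0) < \<bar>k x0\<bar> / 2"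
    using k_cont \<open>x0 \<ge> 0\<close> unfolding continuous_on_iff
    by (metis atLeast_iff half_gt_zero_iff zero_less_abs_iff)
  define bump where "bump x = max 0 (\<delta> - \<bar>x - x0\<bar>)" for x
  \<comment> \<open>\<open>\<phi>\<close> is the tent \<open>bump\<close> in the variable \<open>u = e\<^sup>-\<^sup>x\<close>, cut off so that it is continuous at \<open>u = 0\<close>.\<close>
  define \<phi> where "\<phi> u = max 0 (\<delta> - \<bar>x0 + ln (max u (exp (- x0 - \<delta>)))\<bar>)" for u
  have \<phi>_cont: "continuous_on {0..1} \<phi>"
    unfolding \<phi>_def by (intro continuous_intros) (auto simp: max_def not_le)
  have \<phi>_bump: "\<phi> (exp (- x)) = bump x" for x
  proof -
    have "max (exp (- x)) (exp (- x0 - \<delta>)) = exp (max (- x) (- x0 - \<delta>))"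
      by (simp add: max_def)
    then show ?thesis
      using \<open>\<delta> > 0\<close> by (auto simp: \<phi>_def bump_def max_def)
  qed
  have bump_cont: "continuous_on S bump" for S
    unfolding bump_def by (intro continuous_intros)
  have bump_int: "set_integrable lborel {0..} (\<lambda>x. bump x * k x)"
  proof (rule set_integrable_bound)
    show "set_integrable lborel {0..} (\<lambda>x. \<delta> * k x)"
      by (intro set_integrable_mult_right k_int)
    show "set_borel_measurable lborel {0..} (\<lambda>x. bump x * k x)"
      unfolding set_borel_measurable_def
      by (subst measurable_lborel2, intro borel_measurable_continuous_on_indicator)
        (auto intro!: continuous_intros bump_cont k_cont)
    show "AE x in lborel. x \<in> {0..} \<longrightarrow> norm (bump x * k x) \<le> norm (\<delta> * k x)"
      using \<open>\<delta> > 0\<close> by (intro AE_I2) (auto simp: abs_mult bump_def intro!: mult_right_mono)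
  qed
  define I where "I = (LINT x:{0..}|lborel. bump x * k x)"
  have small: "\<bar>I\<bar> \<le> e * (LINT x:{0..}|lborel. \<bar>k x\<bar>)" if e: "e > 0" for e
  proof -
    obtain p where p: "real_polynomial_function p" "\<And>u. u \<in> {0..1} \<Longrightarrow> \<bar>\<phi> u - p u\<bar> < e"
      using Stone_Weierstrass_real_polynomial_function[OF compact_Icc \<phi>_cont e] by blast
    have "I = (LINT x:{0..}|lborel. bump x * k x) - (LINT x:{0..}|lborel. p (exp (- x)) * k x)"
      by (simp add: I_def poly(2)[OF p(1)])
    also have "\<dots> = (LINT x:{0..}|lborel. bump x * k x - p (exp (- x)) * k x)"
      by (rule set_integral_diff(2)[symmetric, OF bump_int poly(1)[OF p(1)]])
    also have "norm \<dots> \<le> (LINT x:{0..}|lborel. norm (bump x * k x - p (exp (- x)) * k x))"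
      by (intro set_integral_norm_bound set_integral_diff bump_int poly(1)[OF p(1)])
    also have "\<dots> \<le> (LINT x:{0..}|lborel. e * \<bar>k x\<bar>)"
    proof (rule set_integral_mono)
      show "set_integrable lborel {0..} (\<lambda>x. norm (bump x * k x - p (exp (- x)) * k x))"
        by (intro set_integrable_norm set_integral_diff bump_int poly(1)[OF p(1)])
      show "set_integrable lborel {0..} (\<lambda>x. e * \<bar>k x\<bar>)"
        by (intro set_integrable_mult_right set_integrable_abs k_int)
      show "norm (bump x * k x - p (exp (- x)) * k x) \<le> e * \<bar>k x\<bar>" if "x \<in> {0..}" for x
        using p(2)[of "exp (- x)"] that
        by (simp add: \<phi>_bump abs_mult mult_right_mono flip: left_diff_distrib)
    qed
    finally show ?thesis by simp
  qed
  have "I = 0"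
  proof (rule ccontr)
    assume "I \<noteq> 0"
    define J where "J = (LINT x:{0..}|lborel. \<bar>k x\<bar>)"
    have "J \<ge> 0"
      unfolding J_def set_lebesgue_integral_def by (intro Bochner_Integration.integral_nonneg) simp
    \<comment> \<open>The tolerance is chosen so that its product with \<open>J\<close> is below
      \<open>\<bar>I\<bar>\<close>; the summand 1 covers \<open>J = 0\<close>.\<close>
    have "\<bar>I\<bar> \<le> \<bar>I\<bar> / (2 * (J + 1)) * J"
      unfolding J_def using \<open>I \<noteq> 0\<close> \<open>J \<ge> 0\<close> by (intro small) (simp add: J_def)
    also have "\<dots> < \<bar>I\<bar>"
      using \<open>I \<noteq> 0\<close> \<open>J \<ge> 0\<close> mult_nonneg_nonneg[of J "\<bar>I\<bar>"] by (simp add: field_simps add_nonneg_pos)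
    finally show False by simp
  qed
  \<comment> \<open>The factor \<open>sgn (k x0)\<close> makes the integrand nonnegative on the
    support of the tent.\<close>
  define F where "F x = indicator {0..} x * (sgn (k x0) * (bump x * k x))" for x
  have F_int: "integrable lborel F"
    using bump_int unfolding F_def set_integrable_def
    by (auto simp: mult.left_commute[of _ "sgn (k x0)"])
  have F_zero: "(LINT x|lborel. F x) = 0"
    using \<open>I = 0\<close> unfolding F_def I_def set_lebesgue_integral_def
    by (auto simp: mult.left_commute[of _ "sgn (k x0)"])
  have k_sign: "sgn (k x0) * k x \<ge> \<bar>k x0\<bar> / 2" if "x \<ge> 0" "\<bar>x - x0\<bar> < \<delta>" for x
    using \<delta>(2)[OF that(1)] that(2) \<open>k x0 \<noteq> 0\<close>
    by (auto simp: dist_real_def sgn_if abs_if field_simps split: if_splits)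
  \<comment> \<open>The interval lies to the right of \<open>x0\<close>, hence inside
    \<open>{0..}\<close> even when \<open>x0 = 0\<close>; on it the tent is at least
    \<open>\<delta> / 2\<close>.\<close>
  have "(LINT x|lborel. indicator {x0..x0 + \<delta> / 2} x * (\<delta> / 2 * (\<bar>k x0\<bar> / 2))) \<le> (LINT x|lborel. F x)"
  proof (rule integral_mono)
    show "integrable lborel (\<lambda>x. indicator {x0..x0 + \<delta> / 2} x * (\<delta> / 2 * (\<bar>k x0\<bar> / 2)))"
      by (intro integrable_mult_left integrable_real_indicator) (auto simp: emeasure_lborel_Icc_eq)
    show "integrable lborel F" by (rule F_int)
    show "indicator {x0..x0 + \<delta> / 2} x * (\<delta> / 2 * (\<bar>k x0\<bar> / 2)) \<le> F x" for x
    proof (cases "x \<in> {x0..x0 + \<delta> / 2}")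
      case True
      have "\<delta> / 2 * (\<bar>k x0\<bar> / 2) \<le> bump x * (sgn (k x0) * k x)"
        using True \<open>x0 \<ge> 0\<close> \<open>\<delta> > 0\<close> by (intro mult_mono k_sign) (auto simp: bump_def)
      with True \<open>x0 \<ge> 0\<close> show ?thesis
        by (simp add: F_def mult.left_commute)
    next
      case False
      have "0 \<le> bump x * (sgn (k x0) * k x)" if "x \<ge> 0"
      proof (cases "\<bar>x - x0\<bar> < \<delta>")
        case True
        have "0 \<le> sgn (k x0) * k x"
          using k_sign[OF that True] abs_ge_zero[of "k x0"] by linarith
        then show ?thesis
          by (rule mult_nonneg_nonneg[rotated]) (simp add: bump_def)
      qed (simp add: bump_def)
      with False show ?thesis
        by (simp add: F_def mult.left_commute split: split_indicator)
    qed
  qed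
  moreover have "(LINT x|lborel. indicator {x0..x0 + \<delta> / 2} x * (\<delta> / 2 * (\<bar>k x0\<bar> / 2))) > 0"
    using \<open>\<delta> > 0\<close> \<open>k x0 \<noteq> 0\<close> by simp
  ultimately show False
    using F_zero by simp
qed

lemma laplace_transform_unique:
  fixes f g :: "real \<Rightarrow> real"
  assumes cont: "continuous_on {0..} f" "continuous_on {0..} g"
    and int: "\<And>\<theta>. \<theta> > \<theta>0 \<Longrightarrow> set_integrable lborel {0..} (\<lambda>x. exp (- \<theta> * x) * f x)"
      "\<And>\<theta>. \<theta> > \<theta>0 \<Longrightarrow> set_integrable lborel {0..} (\<lambda>x. exp (- \<theta> * x) * g x)"
    and eq: "\<And>\<theta>. \<theta> > \<theta>0 \<Longrightarrow> (LINT x:{0..}|lborel. exp (- \<theta> * x) * f x) = (LINT x:{0..}|lborel. exp (- \<theta> * x) * g x)"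
    and "x \<ge> 0"
  shows "f x = g x"
proof -
  have "f x - g x = 0"
  proof (rule laplace_transform_zero[of "\<lambda>x. f x - g x" \<theta>0])
    show "continuous_on {0..} (\<lambda>x. f x - g x)"
      by (intro continuous_intros cont)
    show "set_integrable lborel {0..} (\<lambda>x. exp (- \<theta> * x) * (f x - g x))"
      "(LINT x:{0..}|lborel. exp (- \<theta> * x) * (f x - g x)) = 0" if "\<theta> > \<theta>0" for \<theta>
      using set_integral_diff[OF int(1)[OF that] int(2)[OF that]] eq[OF that]
      by (simp_all add: right_diff_distrib)
  qed fact
  then show ?thesis by simp
qed

section \<open>The resolvent of the block matrix\<close>

lemma block_mat_mult_vec:
  "block_mat c r v A *v block_vec x y = block_vec (c * x + r \<bullet> y) (x *\<^sub>R v + A *v y)"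
proof -
  have sum_opt: "(\<Sum>j\<in>UNIV. f j) = f None + (\<Sum>k\<in>UNIV. f (Some k))" for f :: "'a option \<Rightarrow> real"
    by (simp add: UNIV_option_conv sum.reindex)
  show ?thesis
    by (simp add: vec_eq_iff block_mat_def block_vec_def matrix_vector_mult_def sum_opt inner_vec_def
        mult.commute split: option.split)
qed

lemma block_vec_components: "z = block_vec (z $ None) (\<chi> k. z $ Some k)"
  by (simp add: vec_eq_iff block_vec_def split: option.split)

lemma block_vec_eq_iff: "block_vec x u = block_vec y v \<longleftrightarrow> x = y \<and> u = v"
proof
  assume eq: "block_vec x u = block_vec y v"
  show "x = y \<and> u = v"
    using arg_cong[where f = "\<lambda>z. z $ None", OF eq] arg_cong[where f = "\<lambda>z. z $ Some k" for k, OF eq]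
    by (simp add: block_vec_def vec_eq_iff)
qed simp

lemma block_vec_linear:
  "c *\<^sub>R block_vec x u = block_vec (c * x) (c *\<^sub>R u)"
  "block_vec x u - block_vec y v = block_vec (x - y) (u - v)"
  by (auto simp: vec_eq_iff block_vec_def split: option.splits)

context minimal_me
begin

text \<open>The linear system for \<open>z\<close> is solved by blocks: the lower block gives
  \<open>u\<close> in terms of \<open>x\<close>, and the resolvent identity reduces the remaining
  scalar equation to values of \<open>\<Psi>\<close>. In the application \<open>\<Psi>\<close> is
  \<open>2 * \<psi> / \<sigma>\<^sup>2\<close> up to a constant, and the numerator of the last
  fraction is its derivative at \<open>\<phi>\<close>.\<close>

lemma block_resolvent:
  fixes \<kappa> m \<phi> \<theta> :: real
  defines "G \<equiv> block_mat (- (\<phi> + m)) ((\<kappa> *\<^sub>R \<alpha>) v* R \<phi>) t T"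
    and "\<Psi> \<equiv> \<lambda>\<theta>. \<theta>\<^sup>2 + m * \<theta> + \<kappa> * me_laplace \<alpha> T \<theta>"
  assumes \<phi>: "\<phi> \<ge> 0" and \<theta>: "\<theta> > \<phi>" and ne: "\<Psi> \<theta> \<noteq> \<Psi> \<phi>"
    and inv: "invertible (mat \<theta> - G)"
  shows "axis None 1 \<bullet> (matrix_inv (mat \<theta> - G) *v block_vec 1 (R \<phi> *v t))
     = 1 / (\<theta> - \<phi>) - (2 * \<phi> + m - \<kappa> * (\<alpha> \<bullet> (R \<phi> *v (R \<phi> *v t)))) / (\<Psi> \<theta> - \<Psi> \<phi>)"
proof -
  define z where "z = matrix_inv (mat \<theta> - G) *v block_vec 1 (R \<phi> *v t)"
  define x where "x = z $ None"
  define u where "u = (\<chi> k. z $ Some k)"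
  have z: "z = block_vec x u"
    unfolding x_def u_def by (rule block_vec_components)
  have "(mat \<theta> - G) *v z = block_vec 1 (R \<phi> *v t)"
    by (simp add: z_def matrix_vector_mul_assoc matrix_inv_mult[OF inv])
  then have 1: "\<theta> * x - (- (\<phi> + m) * x + ((\<kappa> *\<^sub>R \<alpha>) v* R \<phi>) \<bullet> u) = 1"
    and 2: "\<theta> *\<^sub>R u - (x *\<^sub>R t + T *v u) = R \<phi> *v t"
    unfolding z matrix_vector_mult_diff_rdistrib mat_scaled_mult G_def block_mat_mult_vec
      block_vec_linear block_vec_eq_iff by auto
  have "(mat \<theta> - T) *v u = R \<phi> *v t + x *\<^sub>R t"
    using 2 by (simp add: matrix_vector_mult_diff_rdistrib mat_scaled_mult algebra_simps)
  then have "R \<theta> *v ((mat \<theta> - T) *v u) = R \<theta> *v (R \<phi> *v t) + x *\<^sub>R (R \<theta> *v t)"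
    by (simp add: algebra_simps)
  then have u: "u = R \<theta> *v (R \<phi> *v t) + x *\<^sub>R (R \<theta> *v t)"
    using \<theta> \<phi> by (simp add: matrix_vector_mul_assoc matrix_inv_mult resolvent_invertible)
  define A1 where "A1 = \<alpha> \<bullet> (R \<phi> *v (R \<theta> *v t))"
  define A2 where "A2 = \<alpha> \<bullet> (R \<phi> *v (R \<theta> *v (R \<phi> *v t)))"
  define A3 where "A3 = \<alpha> \<bullet> (R \<phi> *v (R \<phi> *v t))"
  have A1: "(\<theta> - \<phi>) * A1 = me_laplace \<alpha> T \<phi> - me_laplace \<alpha> T \<theta>"
    using arg_cong[where f = "\<lambda>v. \<alpha> \<bullet> v", OF resolvent_identity[of \<phi> \<theta> t]] \<theta> \<phi>
    by (simp add: A1_def me_laplace_def inner_diff_right)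
  have A1': "(\<theta> - \<phi>) * (\<alpha> \<bullet> (R \<theta> *v (R \<phi> *v t))) = me_laplace \<alpha> T \<phi> - me_laplace \<alpha> T \<theta>"
    using arg_cong[where f = "\<lambda>v. \<alpha> \<bullet> v", OF resolvent_identity[of \<theta> \<phi> t]] \<theta> \<phi>
    by (simp add: me_laplace_def inner_diff_right algebra_simps)
  \<comment> \<open>The two resolvents commute under \<open>\<alpha>\<close>, since both orders
    satisfy the same identity.\<close>
  have "(\<theta> - \<phi>) * A1 = (\<theta> - \<phi>) * (\<alpha> \<bullet> (R \<theta> *v (R \<phi> *v t)))"
    unfolding A1 A1' ..
  then have A1_sym: "\<alpha> \<bullet> (R \<theta> *v (R \<phi> *v t)) = A1"
    using \<theta> by simp
  have A2: "(\<theta> - \<phi>) * A2 = A3 - A1"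
    using arg_cong[where f = "\<lambda>v. \<alpha> \<bullet> v", OF resolvent_identity[of \<phi> \<theta> "R \<phi> *v t"]] \<theta> \<phi>
    by (simp add: A1_sym A2_def A3_def inner_diff_right)
  have "((\<kappa> *\<^sub>R \<alpha>) v* R \<phi>) \<bullet> u = \<kappa> * (A2 + x * A1)"
    by (simp add: u dot_lmul_matrix matrix_vector_right_distrib matrix_vector_mult_scaleR
        inner_add_right A1_def A2_def distrib_left)
  with 1 have x: "x * (\<theta> + \<phi> + m - \<kappa> * A1) = 1 + \<kappa> * A2"
    by (simp add: algebra_simps)
  \<comment> \<open>The coefficient of \<open>x\<close> is the difference quotient of
    \<open>\<Psi>\<close>.\<close>
  have D: "(\<theta> - \<phi>) * (\<theta> + \<phi> + m - \<kappa> * A1) = \<Psi> \<theta> - \<Psi> \<phi>"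
    using arg_cong[where f = "\<lambda>y. \<kappa> * y", OF A1] by (simp add: \<Psi>_def algebra_simps power2_eq_square)
  have "x * (\<Psi> \<theta> - \<Psi> \<phi>) = (\<theta> - \<phi>) * (x * (\<theta> + \<phi> + m - \<kappa> * A1))"
    unfolding D[symmetric] by simp
  also have "\<dots> = (\<theta> - \<phi>) + \<kappa> * ((\<theta> - \<phi>) * A2)"
    unfolding x by (simp add: algebra_simps)
  also have "\<dots> = (\<theta> + \<phi> + m - \<kappa> * A1) - (2 * \<phi> + m - \<kappa> * A3)"
    unfolding A2 by (simp add: algebra_simps)
  also have "\<theta> + \<phi> + m - \<kappa> * A1 = (\<Psi> \<theta> - \<Psi> \<phi>) / (\<theta> - \<phi>)"
    using D \<theta> by (simp add: field_simps)
  finally have "x = ((\<Psi> \<theta> - \<Psi> \<phi>) / (\<theta> - \<phi>) - (2 * \<phi> + m - \<kappa> * A3)) / (\<Psi> \<theta> - \<Psi> \<phi>)"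
    using ne by (intro eq_divide_imp) auto
  then have "x = 1 / (\<theta> - \<phi>) - (2 * \<phi> + m - \<kappa> * A3) / (\<Psi> \<theta> - \<Psi> \<phi>)"
    unfolding diff_divide_distrib[of "(\<Psi> \<theta> - \<Psi> \<phi>) / (\<theta> - \<phi>)"] using ne by simp
  then show ?thesis
    by (simp add: x_def z_def A3_def inner_axis')
qed

end

section \<open>The Laplace exponent\<close>

text \<open>Completing the square: the exponential tilt moves the mean to \<open>s\<close> and
  leaves a constant factor.\<close>

lemma nn_integral_exp_std_normal:
  "(\<integral>\<^sup>+x. ennreal (normal_density 0 1 x) * ennreal (exp (s * x)) \<partial>lborel) = ennreal (exp (s\<^sup>2 / 2))"
proof -
  have "ennreal (normal_density 0 1 x) * ennreal (exp (s * x)) =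
      ennreal (exp (s\<^sup>2 / 2)) * ennreal (normal_density s 1 x)" for x
  proof -
    have "normal_density 0 1 x * exp (s * x) = exp (s\<^sup>2 / 2) * normal_density s 1 x"
      by (simp add: normal_density_def power2_eq_square field_simps flip: exp_add)
    then show ?thesis
      by (simp flip: ennreal_mult)
  qed
  then have "(\<integral>\<^sup>+x. ennreal (normal_density 0 1 x) * ennreal (exp (s * x)) \<partial>lborel) =
      ennreal (exp (s\<^sup>2 / 2)) * (\<integral>\<^sup>+x. ennreal (normal_density s 1 x) \<partial>lborel)"
    by (simp add: nn_integral_cmult)
  also have "(\<integral>\<^sup>+x. ennreal (normal_density s 1 x) \<partial>lborel) = 1"
    by (subst nn_integral_eq_integral) auto
  finally show ?thesis by simp
qed

context prob_space
begin

lemma nn_integral_exp_brownian: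
  assumes "standard_brownian_motion B"
  shows "(\<integral>\<^sup>+w. ennreal (exp (s * B 1 w)) \<partial>M) = ennreal (exp (s\<^sup>2 / 2))"
proof -
  have zero: "AE w in M. B 0 w = 0"
    and D: "distributed M lborel (\<lambda>w. B 1 w - B 0 w) (normal_density 0 1)"
    using assms unfolding standard_brownian_motion_def by (auto dest!: spec2[of _ 0 1])
  have "(\<integral>\<^sup>+w. ennreal (exp (s * B 1 w)) \<partial>M) = (\<integral>\<^sup>+w. ennreal (exp (s * (B 1 w - B 0 w))) \<partial>M)"
    using zero by (intro nn_integral_cong_AE, eventually_elim) simp
  also have "\<dots> = (\<integral>\<^sup>+x. ennreal (normal_density 0 1 x) * ennreal (exp (s * x)) \<partial>lborel)"
    by (rule distributed_nn_integral[OF D, symmetric]) simp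
  finally show ?thesis
    by (simp add: nn_integral_exp_std_normal)
qed

lemma emeasure_poisson_process:
  assumes "poisson_process rate N" "rate > 0"
  shows "emeasure M {w \<in> space M. N 1 w = n} = ennreal (rate ^ n / fact n * exp (- rate))"
proof -
  have zero: "AE w in M. N 0 w = 0"
    and D: "distr M (count_space UNIV) (\<lambda>w. N 1 w - N 0 w) = measure_pmf (poisson_pmf rate)"
    and [measurable]: "N 0 \<in> measurable M (count_space UNIV)" "N 1 \<in> measurable M (count_space UNIV)"
    using assms unfolding poisson_process_def by (auto dest!: spec2[of _ 0 1])
  have "emeasure M {w \<in> space M. N 1 w = n} = emeasure M {w \<in> space M. N 1 w - N 0 w = n}"
    using zero by (intro emeasure_eq_AE) (auto elim!: eventually_mono)
  also have "\<dots> = emeasure (distr M (count_space UNIV) (\<lambda>w. N 1 w - N 0 w)) {n}"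
    by (subst emeasure_distr) (auto intro!: arg_cong[where f = "emeasure M"])
  also have "\<dots> = ennreal (rate ^ n / fact n * exp (- rate))"
    using assms(2) by (simp add: D emeasure_pmf_single)
  finally show ?thesis .
qed

text \<open>Lets a functional of a process inherit independence from the sigma-algebra that the
  process generates.\<close>

lemma process_sigma_vimage:
  fixes f :: "'a \<Rightarrow> 'c"
  assumes f: "f \<in> measurable (sigma (space M) (\<Union>i\<in>I. {Y i -` A \<inter> space M |A. A \<in> sets S})) L"
  shows "{f -` A \<inter> space M |A. A \<in> sets L} \<subseteq> process_sigma I S Y"
proof -
  have "(\<Union>i\<in>I. {Y i -` A \<inter> space M |A. A \<in> sets S}) \<subseteq> Pow (space M)"
    by auto
  then show ?thesis
    using measurable_sets[OF f] unfolding process_sigma_def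
    by (auto simp: sets_measure_of space_measure_of_conv)
qed

lemma process_measurable_sigma:
  assumes "i \<in> I" and "Y i \<in> measurable M S"
  shows "Y i \<in> measurable (sigma (space M) (\<Union>i\<in>I. {Y i -` A \<inter> space M |A. A \<in> sets S})) S"
proof (rule measurableI)
  have sub: "(\<Union>i\<in>I. {Y i -` A \<inter> space M |A. A \<in> sets S}) \<subseteq> Pow (space M)"
    by auto
  show "Y i x \<in> space S" if "x \<in> space (sigma (space M) (\<Union>i\<in>I. {Y i -` A \<inter> space M |A. A \<in> sets S}))" for x
    using that assms(2) by (auto simp: space_measure_of_conv dest: measurable_space)
  show "Y i -` A \<inter> space (sigma (space M) (\<Union>i\<in>I. {Y i -` A \<inter> space M |A. A \<in> sets S}))
      \<in> sets (sigma (space M) (\<Union>i\<in>I. {Y i -` A \<inter> space M |A. A \<in> sets S}))" if "A \<in> sets S" for A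
    using that assms(1) sub by (auto simp: space_measure_of_conv sets_measure_of intro!: sigma_sets.Basic)
qed

text \<open>Splitting on the value \<open>n\<close> of \<open>N 1\<close> gives a series whose terms
  factor into a Brownian part \<open>Y\<close>, an indicator \<open>J n\<close> and a product over
  jumps \<open>P n\<close>. Independence multiplies the expectations, and the Poisson weights sum to
  an exponential. Nonnegative extended integrals justify exchanging sum and integral.\<close>

lemma compound_poisson_exponent:
  fixes B :: "real \<Rightarrow> 'a \<Rightarrow> real" and N :: "real \<Rightarrow> 'a \<Rightarrow> nat" and C :: "nat \<Rightarrow> 'a \<Rightarrow> real"
  assumes brownian: "standard_brownian_motion B"
    and poisson: "poisson_process rate N" and rate: "rate > 0"
    and iid: "indep_vars (\<lambda>_. borel) C {1..}"
    and indep: "independent_drivers B N C"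
    and X: "\<And>w. X 1 w = d + \<sigma> * B 1 w - (\<Sum>j=1..N 1 w. C j w)"
    and L: "\<And>j. j \<ge> 1 \<Longrightarrow> (\<integral>\<^sup>+w. ennreal (exp (- \<theta> * C j w)) \<partial>M) = ennreal l" and "l \<ge> 0"
  shows "laplace_exponent M X \<theta> = d * \<theta> + \<sigma>\<^sup>2 / 2 * \<theta>\<^sup>2 + rate * (l - 1)"
proof -
  have B_meas [measurable]: "B 1 \<in> borel_measurable M"
    using brownian unfolding standard_brownian_motion_def by auto
  have N_meas [measurable]: "N 1 \<in> measurable M (count_space UNIV)"
    using poisson unfolding poisson_process_def by auto
  have C_meas: "C j \<in> borel_measurable M" if "j \<ge> 1" for j
    using iid that unfolding indep_vars_def2 by auto
  define Y where "Y w = ennreal (exp (\<sigma> * \<theta> * B 1 w))" for w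
  define J where "J n w = ennreal (of_bool (N 1 w = n))" for n w
  define P where "P n w = (\<Prod>j\<in>{1..n}. ennreal (exp (- \<theta> * C j w)))" for n w
  have C_meas' [measurable]: "C j \<in> borel_measurable M" if "j \<in> {1..n}" for j n
    using that by (intro C_meas) simp
  have meas [measurable]: "Y \<in> borel_measurable M" "J n \<in> borel_measurable M" "P n \<in> borel_measurable M" for n
  proof -
    show "Y \<in> borel_measurable M" "J n \<in> borel_measurable M"
      unfolding Y_def J_def by measurable
    show "P n \<in> borel_measurable M"
      unfolding P_def by (intro borel_measurable_prod_ennreal) measurable
  qed
  have P_int: "(\<integral>\<^sup>+w. P n w \<partial>M) = ennreal (l ^ n)" for n
  proof -
    have "indep_vars (\<lambda>_. borel) (\<lambda>j w. ennreal (exp (- \<theta> * C j w))) {1..n}"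
      by (rule indep_vars_compose2[OF indep_vars_subset[OF iid]]) auto
    then have "(\<integral>\<^sup>+w. P n w \<partial>M) = (\<Prod>j\<in>{1..n}. (\<integral>\<^sup>+w. ennreal (exp (- \<theta> * C j w)) \<partial>M))"
      unfolding P_def by (intro indep_vars_nn_integral) auto
    also have "\<dots> = (\<Prod>j\<in>{1..n}. ennreal l)"
      by (intro prod.cong refl L) simp
    finally show ?thesis
      using \<open>l \<ge> 0\<close> by (simp add: ennreal_power)
  qed
  have J_int: "(\<integral>\<^sup>+w. J n w \<partial>M) = ennreal (rate ^ n / fact n * exp (- rate))" for n
  proof -
    have "(\<integral>\<^sup>+w. J n w \<partial>M) = (\<integral>\<^sup>+w. indicator {w \<in> space M. N 1 w = n} w \<partial>M)"
      by (intro nn_integral_cong) (auto simp: J_def indicator_def)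
    also have "\<dots> = emeasure M {w \<in> space M. N 1 w = n}"
      by (intro nn_integral_indicator) measurable
    finally show ?thesis
      using emeasure_poisson_process[OF poisson rate] by simp
  qed
  have Y_int: "(\<integral>\<^sup>+w. Y w \<partial>M) = ennreal (exp ((\<sigma> * \<theta>)\<^sup>2 / 2))"
    unfolding Y_def by (rule nn_integral_exp_brownian[OF brownian])
  have prod3: "(\<integral>\<^sup>+w. Y w * J n w * P n w \<partial>M) = (\<integral>\<^sup>+w. Y w \<partial>M) * (\<integral>\<^sup>+w. J n w \<partial>M) * (\<integral>\<^sup>+w. P n w \<partial>M)" for n
  proof -
    \<comment> \<open>The factors are listed in the order of \<open>independent_drivers\<close>, so
      its independent sigma-algebras apply index by index.\<close>
    define Z where "Z i = [Y, J n, P n] ! i" for i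
    have "indep_vars (\<lambda>_. borel) Z {..<3}"
      unfolding indep_vars_def2
    proof
      show "\<forall>i\<in>{..<3}. Z i \<in> borel_measurable M"
        by (auto simp: Z_def numeral_3_eq_3 less_Suc_eq)
      show "indep_sets (\<lambda>i. {Z i -` A \<inter> space M |A. A \<in> sets borel}) {..<3}"
      proof (rule indep_sets_mono_sets[OF indep[unfolded independent_drivers_def]])
        have Y_sub: "{Y -` A \<inter> space M |A. A \<in> sets borel} \<subseteq> process_sigma {0..} borel B"
        proof (rule process_sigma_vimage)
          have [measurable]: "B 1 \<in> measurable (sigma (space M) (\<Union>i\<in>{0..}. {B i -` A \<inter> space M |A. A \<in> sets borel})) borel"
            by (rule process_measurable_sigma) auto
          show "Y \<in> measurable (sigma (space M) (\<Union>i\<in>{0..}. {B i -` A \<inter> space M |A. A \<in> sets borel})) borel"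
            unfolding Y_def by measurable
        qed
        have J_sub: "{J n -` A \<inter> space M |A. A \<in> sets borel} \<subseteq> process_sigma {0..} (count_space UNIV) N"
        proof (rule process_sigma_vimage)
          have [measurable]: "N 1 \<in> measurable (sigma (space M) (\<Union>i\<in>{0..}. {N i -` A \<inter> space M |A. A \<in> sets (count_space UNIV)})) (count_space UNIV)"
            by (rule process_measurable_sigma) auto
          show "J n \<in> measurable (sigma (space M) (\<Union>i\<in>{0..}. {N i -` A \<inter> space M |A. A \<in> sets (count_space UNIV)})) borel"
            unfolding J_def by measurable
        qed
        have P_sub: "{P n -` A \<inter> space M |A. A \<in> sets borel} \<subseteq> process_sigma {1..} borel C"
        proof (rule process_sigma_vimage)
          have [measurable]: "C j \<in> measurable (sigma (space M) (\<Union>i\<in>{1..}. {C i -` A \<inter> space M |A. A \<in> sets borel})) borel"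
            if "j \<in> {1..n}" for j
            using that by (intro process_measurable_sigma C_meas) auto
          show "P n \<in> measurable (sigma (space M) (\<Union>i\<in>{1..}. {C i -` A \<inter> space M |A. A \<in> sets borel})) borel"
            unfolding P_def by (intro borel_measurable_prod_ennreal) measurable
        qed
        show "{Z i -` A \<inter> space M |A. A \<in> sets borel} \<subseteq>
            [process_sigma {0..} borel B, process_sigma {0..} (count_space UNIV) N, process_sigma {1..} borel C] ! i"
          if i: "i \<in> {..<3}" for i
        proof -
          consider "i = 0" | "i = 1" | "i = 2"
            using i by force
          then show ?thesis
            using Y_sub J_sub P_sub by cases (simp_all add: Z_def)
        qed
      qed
    qed
    then have "(\<integral>\<^sup>+w. (\<Prod>i\<in>{..<3}. Z i w) \<partial>M) = (\<Prod>i\<in>{..<3}. (\<integral>\<^sup>+w. Z i w \<partial>M))"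
      by (intro indep_vars_nn_integral) auto
    then show ?thesis
      by (simp add: Z_def numeral_3_eq_3 lessThan_Suc mult_ac)
  qed
  have X_eq: "ennreal (exp (\<theta> * X 1 w)) = ennreal (exp (\<theta> * d)) * (\<Sum>n. Y w * J n w * P n w)" for w
  proof -
    have "(\<Sum>n. Y w * J n w * P n w) = (\<Sum>n\<in>{N 1 w}. Y w * J n w * P n w)"
      by (intro suminf_finite) (auto simp: J_def)
    also have "\<dots> = ennreal (exp (\<sigma> * \<theta> * B 1 w) * (\<Prod>j\<in>{1..N 1 w}. exp (- \<theta> * C j w)))"
      by (simp add: J_def Y_def P_def prod_ennreal flip: ennreal_mult')
    also have "(\<Prod>j\<in>{1..N 1 w}. exp (- \<theta> * C j w)) = exp (- \<theta> * (\<Sum>j=1..N 1 w. C j w))"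
      by (simp only: sum_distrib_left exp_sum[OF finite_atLeastAtMost])
    finally have "ennreal (exp (\<theta> * d)) * (\<Sum>n. Y w * J n w * P n w) =
        ennreal (exp (\<theta> * d) * (exp (\<sigma> * \<theta> * B 1 w) * exp (- \<theta> * (\<Sum>j=1..N 1 w. C j w))))"
      by (simp only: ennreal_mult' exp_ge_zero)
    also have "exp (\<theta> * d) * (exp (\<sigma> * \<theta> * B 1 w) * exp (- \<theta> * (\<Sum>j=1..N 1 w. C j w))) =
        exp (\<theta> * d + (\<sigma> * \<theta> * B 1 w + - \<theta> * (\<Sum>j=1..N 1 w. C j w)))"
      by (simp only: exp_add)
    also have "\<theta> * d + (\<sigma> * \<theta> * B 1 w + - \<theta> * (\<Sum>j=1..N 1 w. C j w)) = \<theta> * X 1 w"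
      by (simp add: X algebra_simps)
    finally show ?thesis ..
  qed
  have "(\<integral>\<^sup>+w. ennreal (exp (\<theta> * X 1 w)) \<partial>M) = ennreal (exp (\<theta> * d)) * (\<Sum>n. (\<integral>\<^sup>+w. Y w * J n w * P n w \<partial>M))"
    unfolding X_eq by (subst nn_integral_cmult) (auto simp: nn_integral_suminf)
  also have "\<dots> = ennreal (exp (\<theta> * d)) *
      (\<Sum>n. ennreal (exp ((\<sigma> * \<theta>)\<^sup>2 / 2) * exp (- rate) * ((rate * l) ^ n /\<^sub>R fact n)))"
  proof -
    have "(\<integral>\<^sup>+w. Y w * J n w * P n w \<partial>M) =
        ennreal (exp ((\<sigma> * \<theta>)\<^sup>2 / 2) * exp (- rate) * ((rate * l) ^ n /\<^sub>R fact n))" for n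
    proof -
      have "(\<integral>\<^sup>+w. Y w * J n w * P n w \<partial>M) =
          ennreal (exp ((\<sigma> * \<theta>)\<^sup>2 / 2)) * ennreal (rate ^ n / fact n * exp (- rate)) * ennreal (l ^ n)"
        by (simp only: prod3 Y_int J_int P_int)
      also have "\<dots> = ennreal (exp ((\<sigma> * \<theta>)\<^sup>2 / 2) * (rate ^ n / fact n * exp (- rate)) * l ^ n)"
        using rate \<open>l \<ge> 0\<close> by (subst (1 2) ennreal_mult) auto
      also have "exp ((\<sigma> * \<theta>)\<^sup>2 / 2) * (rate ^ n / fact n * exp (- rate)) * l ^ n =
          exp ((\<sigma> * \<theta>)\<^sup>2 / 2) * exp (- rate) * ((rate * l) ^ n /\<^sub>R fact n)"
        by (simp add: power_mult_distrib scaleR_conv_of_real field_simps)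
      finally show ?thesis .
    qed
    then show ?thesis by simp
  qed
  also have "(\<Sum>n. ennreal (exp ((\<sigma> * \<theta>)\<^sup>2 / 2) * exp (- rate) * ((rate * l) ^ n /\<^sub>R fact n))) =
      ennreal (exp ((\<sigma> * \<theta>)\<^sup>2 / 2) * exp (- rate) * exp (rate * l))"
    using rate \<open>l \<ge> 0\<close> by (intro suminf_ennreal_eq sums_mult exp_converges) auto
  also have "ennreal (exp (\<theta> * d)) * \<dots> =
      ennreal (exp (\<theta> * d) * (exp ((\<sigma> * \<theta>)\<^sup>2 / 2) * exp (- rate) * exp (rate * l)))"
    by (simp only: ennreal_mult' exp_ge_zero)
  also have "exp (\<theta> * d) * (exp ((\<sigma> * \<theta>)\<^sup>2 / 2) * exp (- rate) * exp (rate * l)) =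
      exp (\<theta> * d + ((\<sigma> * \<theta>)\<^sup>2 / 2 + - rate + rate * l))"
    by (simp only: exp_add)
  also have "\<theta> * d + ((\<sigma> * \<theta>)\<^sup>2 / 2 + - rate + rate * l) = d * \<theta> + \<sigma>\<^sup>2 / 2 * \<theta>\<^sup>2 + rate * (l - 1)"
    by (simp add: algebra_simps power_mult_distrib)
  finally have nn: "(\<integral>\<^sup>+w. ennreal (exp (\<theta> * X 1 w)) \<partial>M) =
      ennreal (exp (d * \<theta> + \<sigma>\<^sup>2 / 2 * \<theta>\<^sup>2 + rate * (l - 1)))" .
  have X_meas: "(\<lambda>w. exp (\<theta> * X 1 w)) \<in> borel_measurable M"
  proof -
    have "(\<lambda>w. \<Sum>j=1..n. C j w) \<in> borel_measurable M" for n
      by (intro borel_measurable_sum) measurable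
    then have [measurable]: "(\<lambda>w. \<Sum>j=1..N 1 w. C j w) \<in> borel_measurable M"
      by (rule measurable_compose_countable[OF _ N_meas])
    show ?thesis
      unfolding X by measurable
  qed
  have "(LINT w|M. exp (\<theta> * X 1 w)) = exp (d * \<theta> + \<sigma>\<^sup>2 / 2 * \<theta>\<^sup>2 + rate * (l - 1))"
    using X_meas nn by (subst integral_eq_nn_integral) auto
  then show ?thesis
    by (simp add: laplace_exponent_def)
qed

end

section \<open>The scale function\<close>

context minimal_me
begin

lemma me_laplace_nonneg: "\<theta> \<ge> 0 \<Longrightarrow> me_laplace \<alpha> T \<theta> \<ge> 0"
  using cone_inner_nonneg[OF cone_resolvent[OF \<alpha>_in_cone]]
  by (simp add: me_laplace_def dot_lmul_matrix)

lemma me_laplace_0: "me_laplace \<alpha> T 0 = 1"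
proof -
  have "ennreal (me_laplace \<alpha> T 0) = 1"
    using me_laplace_nn_integral[of 0] density_integral by simp
  then show ?thesis
    using me_laplace_nonneg[of 0] by (simp add: ennreal_eq_1)
qed

end

section \<open>The Laplace exponent on the half line, its largest root and the scale
  function\<close>

locale levy_exponent = minimal_me \<alpha> T
  for \<alpha> :: "real ^ 'p" and T :: "real ^ 'p ^ 'p" +
  fixes d \<sigma> rate q \<omega> \<eta> \<kappa> m \<Phi> :: real and \<psi> :: "real \<Rightarrow> real"
  assumes \<sigma>: "\<sigma> > 0" and rate: "rate > 0" and q: "q \<ge> 0"
    and \<omega>_def: "\<omega> = (sqrt (d\<^sup>2 + 2 * \<sigma>\<^sup>2 * (rate + q)) + d) / \<sigma>\<^sup>2"
    and \<eta>_def: "\<eta> = (sqrt (d\<^sup>2 + 2 * \<sigma>\<^sup>2 * (rate + q)) - d) / \<sigma>\<^sup>2"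
    and \<kappa>_def: "\<kappa> = 2 * rate / \<sigma>\<^sup>2"
    and m_def: "m = 2 * d / \<sigma>\<^sup>2"
    and \<psi>: "\<And>\<theta>. \<theta> \<ge> 0 \<Longrightarrow> \<psi> \<theta> = d * \<theta> + \<sigma>\<^sup>2 / 2 * \<theta>\<^sup>2 + rate * (me_laplace \<alpha> T \<theta> - 1)"
    and \<Phi>_def: "\<Phi> = largest_root \<psi> q"
begin

text \<open>\<open>\<eta>\<close> and \<open>- \<omega>\<close> are the roots of the Brownian part
  \<open>\<theta>\<^sup>2 + m * \<theta> - 2 * (rate + q) / \<sigma>\<^sup>2\<close>; positivity of
  \<open>rate\<close> puts \<open>\<bar>d\<bar>\<close> strictly below the square root.\<close>

lemma discriminant:
  "\<omega> > 0" "\<eta> > 0" "\<omega> - \<eta> = m" "\<omega> * \<eta> = 2 * (rate + q) / \<sigma>\<^sup>2"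
  "\<omega> + \<eta> = 2 * sqrt (d\<^sup>2 + 2 * \<sigma>\<^sup>2 * (rate + q)) / \<sigma>\<^sup>2"
proof -
  define s where "s = sqrt (d\<^sup>2 + 2 * \<sigma>\<^sup>2 * (rate + q))"
  have pos: "2 * \<sigma>\<^sup>2 * (rate + q) > 0"
    using \<sigma> rate q by simp
  have "sqrt (d\<^sup>2) < s"
    unfolding s_def using pos by (intro real_sqrt_less_mono) linarith
  then have "\<bar>d\<bar> < s"
    by simp
  then show "\<omega> > 0" "\<eta> > 0"
    using \<sigma> by (auto simp: \<omega>_def \<eta>_def s_def[symmetric] intro!: divide_pos_pos)
  show "\<omega> - \<eta> = m" "\<omega> + \<eta> = 2 * sqrt (d\<^sup>2 + 2 * \<sigma>\<^sup>2 * (rate + q)) / \<sigma>\<^sup>2"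
    by (simp_all add: \<omega>_def \<eta>_def m_def add_divide_distrib diff_divide_distrib)
  have "s\<^sup>2 = d\<^sup>2 + 2 * \<sigma>\<^sup>2 * (rate + q)"
    using pos by (simp add: s_def)
  then have "(s + d) * (s - d) = \<sigma>\<^sup>2 * (2 * (rate + q))"
    by (simp add: algebra_simps power2_eq_square)
  then show "\<omega> * \<eta> = 2 * (rate + q) / \<sigma>\<^sup>2"
    using \<sigma> by (simp add: \<omega>_def \<eta>_def s_def[symmetric])
qed

lemma psi_quadratic:
  assumes "\<theta> \<ge> 0"
  shows "\<psi> \<theta> - q = \<sigma>\<^sup>2 / 2 * ((\<theta> - \<eta>) * (\<theta> + \<omega>) + \<kappa> * me_laplace \<alpha> T \<theta>)"
proof -
  have "(\<theta> - \<eta>) * (\<theta> + \<omega>) = \<theta>\<^sup>2 + (\<omega> - \<eta>) * \<theta> - \<omega> * \<eta>"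
    by (simp add: algebra_simps power2_eq_square)
  also have "\<dots> = \<theta>\<^sup>2 + m * \<theta> - 2 * (rate + q) / \<sigma>\<^sup>2"
    by (simp only: discriminant)
  finally have eq: "(\<theta> - \<eta>) * (\<theta> + \<omega>) = \<theta>\<^sup>2 + m * \<theta> - 2 * (rate + q) / \<sigma>\<^sup>2" .
  show ?thesis
    unfolding eq \<psi>[OF assms] \<kappa>_def m_def using \<sigma> by (simp add: field_simps)
qed

lemma psi_deriv:
  assumes "\<phi> \<ge> 0"
  shows "(\<psi> has_real_derivative \<sigma>\<^sup>2 / 2 * (2 * \<phi> + m - \<kappa> * (\<alpha> \<bullet> (R \<phi> *v (R \<phi> *v t))))) (at \<phi> within {0..})"
proof -
  have deriv: "((\<lambda>\<theta>. d * \<theta> + \<sigma>\<^sup>2 / 2 * \<theta>\<^sup>2 + rate * (me_laplace \<alpha> T \<theta> - 1)) has_real_derivative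
      (d + \<sigma>\<^sup>2 / 2 * (2 * \<phi>) + rate * - (\<alpha> \<bullet> (R \<phi> *v (R \<phi> *v t))))) (at \<phi> within {0..})"
    by (auto intro!: derivative_eq_intros me_laplace_deriv[OF assms])
  have slope: "d + \<sigma>\<^sup>2 / 2 * (2 * \<phi>) + rate * - (\<alpha> \<bullet> (R \<phi> *v (R \<phi> *v t))) =
      \<sigma>\<^sup>2 / 2 * (2 * \<phi> + m - \<kappa> * (\<alpha> \<bullet> (R \<phi> *v (R \<phi> *v t))))"
    unfolding m_def \<kappa>_def using \<sigma> by (simp add: field_simps)
  show ?thesis
    by (rule has_field_derivative_transform_within[OF deriv[unfolded slope] zero_less_one])
      (use assms in \<open>auto simp: \<psi>\<close>)
qed

text \<open>The derivative within \<open>{0..}\<close> is unique because the nontrivial filter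
  \<open>at_right \<phi>\<close> lies below this one, also at \<open>\<phi> = 0\<close>.\<close>

lemma laplace_exponent_deriv_eq:
  assumes "\<phi> \<ge> 0"
  shows "laplace_exponent_deriv \<psi> \<phi> = \<sigma>\<^sup>2 / 2 * (2 * \<phi> + m - \<kappa> * (\<alpha> \<bullet> (R \<phi> *v (R \<phi> *v t))))"
  unfolding laplace_exponent_deriv_def
proof (rule vector_derivative_within)
  have "at_right \<phi> \<le> at \<phi> within {0..}"
    using assms by (intro at_le) auto
  then show "at \<phi> within {0..} \<noteq> bot"
    using trivial_limit_at_right_real[of \<phi>] by (auto simp: bot_unique)
  show "(\<psi> has_vector_derivative \<sigma>\<^sup>2 / 2 * (2 * \<phi> + m - \<kappa> * (\<alpha> \<bullet> (R \<phi> *v (R \<phi> *v t))))) (at \<phi> within {0..})"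
    using psi_deriv[OF assms] by (simp add: has_real_derivative_iff_has_vector_derivative)
qed

lemma psi_continuous: "continuous_on {0..} \<psi>"
  by (rule DERIV_continuous_on[OF psi_deriv]) simp

lemma psi_ge:
  assumes "\<theta> \<ge> \<eta>"
  shows "\<psi> \<theta> - q \<ge> \<sigma>\<^sup>2 / 2 * ((\<theta> - \<eta>) * (\<theta> + \<omega>))"
  using me_laplace_nonneg[of \<theta>] assms discriminant rate \<sigma>
  by (simp add: psi_quadratic \<kappa>_def)

lemma root_le: "\<theta> \<ge> 0 \<Longrightarrow> \<psi> \<theta> \<le> q \<Longrightarrow> \<theta> \<le> \<eta>"
proof (rule ccontr)
  assume "\<theta> \<ge> 0" "\<psi> \<theta> \<le> q" "\<not> \<theta> \<le> \<eta>"
  moreover from this have "\<sigma>\<^sup>2 / 2 * ((\<theta> - \<eta>) * (\<theta> + \<omega>)) > 0"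
    using discriminant \<sigma> by simp
  ultimately show False
    using psi_ge[of \<theta>] by simp
qed

lemma root_between:
  assumes "0 \<le> a" "\<psi> a \<le> q"
  obtains \<theta> where "a \<le> \<theta>" "\<psi> \<theta> = q"
proof -
  have "\<psi> \<eta> \<ge> q"
    using psi_ge[of \<eta>] by simp
  moreover have "continuous_on {a..\<eta>} \<psi>"
    by (rule continuous_on_subset[OF psi_continuous]) (use assms in auto)
  ultimately have "\<exists>\<theta>\<ge>a. \<theta> \<le> \<eta> \<and> \<psi> \<theta> = q"
    using IVT'[of \<psi> a q \<eta>, OF assms(2) _ root_le[OF assms]] by blast
  then show ?thesis
    using that by blast
qed

text \<open>\<open>GREATEST\<close> has a meaning once a maximum exists: the roots form a compact
  subset of \<open>{0..\<eta>}\<close>, nonempty since \<open>\<psi> 0 = 0 \<le> q\<close>. Beyond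
  the maximum \<open>\<psi>\<close> exceeds \<open>q\<close>, since otherwise the intermediate value
  theorem would give a larger root.\<close>

lemma largest_root_facts:
  shows \<Phi>_nonneg: "0 \<le> \<Phi>" and \<Phi>_root: "\<psi> \<Phi> = q" and \<Phi>_largest: "\<And>\<theta>. \<theta> > \<Phi> \<Longrightarrow> \<psi> \<theta> > q"
proof -
  define S where "S = {\<theta> \<in> {0..\<eta>}. \<psi> \<theta> = q}"
  have "closed S"
    unfolding S_def
    by (intro continuous_closed_preimage_constant continuous_on_subset[OF psi_continuous]) auto
  then have "compact S"
    by (intro compact_eq_bounded_closed[THEN iffD2] conjI bounded_subset[OF bounded_closed_interval[of 0 \<eta>]])
      (auto simp: S_def)
  have "\<psi> 0 \<le> q"
    using q by (simp add: \<psi> me_laplace_0)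
  then obtain \<theta> where "0 \<le> \<theta>" "\<psi> \<theta> = q"
    using root_between[of 0] by auto
  then have "\<theta> \<in> S"
    using root_le by (simp add: S_def)
  then obtain z where z: "z \<in> S" "\<And>y. y \<in> S \<Longrightarrow> y \<le> z"
    using compact_attains_sup[OF \<open>compact S\<close>] by blast
  have "\<Phi> = z"
    unfolding \<Phi>_def largest_root_def using z root_le by (intro Greatest_equality) (auto simp: S_def)
  then show "0 \<le> \<Phi>" "\<psi> \<Phi> = q"
    using z(1) by (auto simp: S_def)
  show "\<psi> \<theta> > q" if \<theta>: "\<theta> > \<Phi>" for \<theta>
  proof (rule ccontr)
    assume "\<not> \<psi> \<theta> > q"
    then have "0 \<le> \<theta>" "\<psi> \<theta> \<le> q"
      using \<theta> \<open>0 \<le> \<Phi>\<close> by auto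
    from root_between[OF this] obtain y where y: "\<theta> \<le> y" "\<psi> y = q" .
    then have "y \<in> S"
      using \<theta> \<open>0 \<le> \<Phi>\<close> root_le by (simp add: S_def)
    with z(2)[of y] y(1) \<theta> \<open>\<Phi> = z\<close> show False by simp
  qed
qed

lemma \<Phi>_le_\<eta>: "\<Phi> \<le> \<eta>"
  using root_le \<Phi>_nonneg \<Phi>_root by simp

lemma scale_function_formula:
  assumes W: "scale_function \<psi> q W" and deriv_pos: "laplace_exponent_deriv \<psi> \<Phi> > 0" and "x \<ge> 0"
  defines "G \<equiv> block_mat (- (\<Phi> + m)) ((\<kappa> *\<^sub>R \<alpha>) v* R \<Phi>) t T"
  shows "W x = 1 / laplace_exponent_deriv \<psi> \<Phi> *
    (exp (\<Phi> * x) - axis None 1 \<bullet> (mat_exp (x *\<^sub>R G) *v block_vec 1 (R \<Phi> *v t)))"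
proof -
  define V where "V = block_vec 1 (R \<Phi> *v t)"
  define D where "D = laplace_exponent_deriv \<psi> \<Phi>"
  define h where "h x = axis None 1 \<bullet> (mat_exp (x *\<^sub>R G) *v V)" for x
  obtain c where c: "\<And>\<theta> u v. \<theta> > c \<Longrightarrow> set_integrable lborel {0..} (\<lambda>x. exp (- \<theta> * x) * (u \<bullet> (mat_exp (x *\<^sub>R G) *v v)))"
    using set_integrable_mat_exp_form[of G] by blast
  \<comment> \<open>Beyond \<open>\<Phi>\<close> the transforms of \<open>W\<close> and of
    e^(\<Phi>x) exist, beyond \<open>c\<close> those of the block matrix exponential.\<close>
  define \<theta>0 where "\<theta>0 = max \<Phi> c"
  have h_cont: "continuous_on {0..} h"
    unfolding h_def by (rule mat_exp_form_continuous)
  have W_cont: "continuous_on {0..} W"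
    using W by (simp add: scale_function_def)
  have W_int: "set_integrable lborel {0..} (\<lambda>x. exp (- \<theta> * x) * W x)"
    and W_laplace: "(LINT x:{0..}|lborel. exp (- \<theta> * x) * W x) = 1 / (\<psi> \<theta> - q)" if "\<theta> > \<theta>0" for \<theta>
  proof -
    have "((\<lambda>x. exp (- \<theta> * x) * W x) has_integral 1 / (\<psi> \<theta> - q)) {0..}"
      using W that by (simp add: scale_function_def \<theta>0_def \<Phi>_def)
    moreover have "0 \<le> exp (- \<theta> * x) * W x" for x
      using W by (simp add: scale_function_def)
    moreover have "continuous_on {0..} (\<lambda>x. exp (- \<theta> * x) * W x)"
      by (intro continuous_intros W_cont)
    ultimately show "set_integrable lborel {0..} (\<lambda>x. exp (- \<theta> * x) * W x)"
      "(LINT x:{0..}|lborel. exp (- \<theta> * x) * W x) = 1 / (\<psi> \<theta> - q)"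
      using set_integrable_nonneg_has_integral by auto
  qed
  have g_int: "set_integrable lborel {0..} (\<lambda>x. exp (- \<theta> * x) * (1 / D * (exp (\<Phi> * x) - h x)))"
    and g_laplace: "(LINT x:{0..}|lborel. exp (- \<theta> * x) * (1 / D * (exp (\<Phi> * x) - h x))) = 1 / (\<psi> \<theta> - q)"
    if "\<theta> > \<theta>0" for \<theta>
  proof -
    have \<theta>: "\<theta> > \<Phi>" "\<theta> > c" "\<theta> \<ge> 0"
      using that \<Phi>_nonneg by (auto simp: \<theta>0_def)
    have exp_eq: "exp (- (\<theta> - \<Phi>) * x) = exp (- \<theta> * x) * exp (\<Phi> * x)" for x
      by (simp add: algebra_simps flip: exp_add)
    have 1: "set_integrable lborel {0..} (\<lambda>x. exp (- \<theta> * x) * exp (\<Phi> * x))"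
      "(LINT x:{0..}|lborel. exp (- \<theta> * x) * exp (\<Phi> * x)) = 1 / (\<theta> - \<Phi>)"
      using set_integrable_exp_minus[of "\<theta> - \<Phi>"] \<theta> unfolding exp_eq by simp_all
    have 2: "set_integrable lborel {0..} (\<lambda>x. exp (- \<theta> * x) * h x)"
      unfolding h_def by (rule c[OF \<theta>(2)])
    define \<Psi> where "\<Psi> \<theta> = \<theta>\<^sup>2 + m * \<theta> + \<kappa> * me_laplace \<alpha> T \<theta>" for \<theta>
    have \<Psi>: "\<psi> \<theta> - q = \<sigma>\<^sup>2 / 2 * (\<Psi> \<theta> - \<Psi> \<Phi>)"
    proof -
      have "\<psi> \<theta> - q = \<psi> \<theta> - \<psi> \<Phi>"
        by (simp add: \<Phi>_root)
      also have "\<dots> = \<sigma>\<^sup>2 / 2 * (\<Psi> \<theta> - \<Psi> \<Phi>)"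
        unfolding \<psi>[OF \<theta>(3)] \<psi>[OF \<Phi>_nonneg] \<Psi>_def m_def \<kappa>_def
        using \<sigma> by (simp add: field_simps)
      finally show ?thesis .
    qed
    have ne: "\<Psi> \<theta> \<noteq> \<Psi> \<Phi>"
      using \<Phi>_largest[OF \<theta>(1)] \<Psi> by auto
    have inv: "invertible (mat \<theta> - G)"
      by (rule resolvent_laplace(1)[OF c[OF \<theta>(2)]])
    have "(LINT x:{0..}|lborel. exp (- \<theta> * x) * h x) = axis None 1 \<bullet> (matrix_inv (mat \<theta> - G) *v V)"
      unfolding h_def by (rule resolvent_laplace(2)[OF c[OF \<theta>(2)], symmetric])
    also have "\<dots> = 1 / (\<theta> - \<Phi>) - (2 * \<Phi> + m - \<kappa> * (\<alpha> \<bullet> (R \<Phi> *v (R \<Phi> *v t)))) / (\<Psi> \<theta> - \<Psi> \<Phi>)"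
      unfolding V_def G_def \<Psi>_def
      by (rule block_resolvent[OF \<Phi>_nonneg \<theta>(1) ne[unfolded \<Psi>_def] inv[unfolded G_def]])
    \<comment> \<open>The numerator is the derivative of \<open>\<psi>\<close> at
      \<open>\<Phi>\<close> up to the factor \<open>\<sigma>\<^sup>2 / 2\<close>. The two terms
      \<open>1 / (\<theta> - \<Phi>)\<close> will cancel, leaving
      \<open>1 / (\<psi> \<theta> - q)\<close>.\<close>
    also have "2 * \<Phi> + m - \<kappa> * (\<alpha> \<bullet> (R \<Phi> *v (R \<Phi> *v t))) = D / (\<sigma>\<^sup>2 / 2)"
      using \<sigma> by (simp add: D_def laplace_exponent_deriv_eq[OF \<Phi>_nonneg])
    also have "D / (\<sigma>\<^sup>2 / 2) / (\<Psi> \<theta> - \<Psi> \<Phi>) = D / (\<psi> \<theta> - q)"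
      by (simp add: \<Psi>)
    finally have 3: "(LINT x:{0..}|lborel. exp (- \<theta> * x) * h x) = 1 / (\<theta> - \<Phi>) - D / (\<psi> \<theta> - q)" .
    have eq: "exp (- \<theta> * x) * (1 / D * (exp (\<Phi> * x) - h x)) =
        1 / D * (exp (- \<theta> * x) * exp (\<Phi> * x) - exp (- \<theta> * x) * h x)" for x
      by (simp add: algebra_simps)
    show "set_integrable lborel {0..} (\<lambda>x. exp (- \<theta> * x) * (1 / D * (exp (\<Phi> * x) - h x)))"
      unfolding eq by (intro set_integrable_mult_right set_integral_diff 1 2)
    have "(LINT x:{0..}|lborel. exp (- \<theta> * x) * (1 / D * (exp (\<Phi> * x) - h x))) =
        1 / D * (1 / (\<theta> - \<Phi>) - (1 / (\<theta> - \<Phi>) - D / (\<psi> \<theta> - q)))"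
      unfolding eq set_integral_mult_right set_integral_diff(2)[OF 1(1) 2] 1(2) 3 ..
    then show "(LINT x:{0..}|lborel. exp (- \<theta> * x) * (1 / D * (exp (\<Phi> * x) - h x))) = 1 / (\<psi> \<theta> - q)"
      using deriv_pos by (simp add: D_def)
  qed
  have "W x = 1 / D * (exp (\<Phi> * x) - h x)"
  proof (rule laplace_transform_unique[OF W_cont _ W_int g_int])
    show "continuous_on {0..} (\<lambda>x. 1 / D * (exp (\<Phi> * x) - h x))"
      by (intro continuous_intros h_cont)
    show "(LINT x:{0..}|lborel. exp (- \<theta> * x) * W x) =
        (LINT x:{0..}|lborel. exp (- \<theta> * x) * (1 / D * (exp (\<Phi> * x) - h x)))" if "\<theta> > \<theta>0" for \<theta>
      unfolding W_laplace[OF that] g_laplace[OF that] ..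
  qed (use \<open>x \<ge> 0\<close> in simp_all)
  then show ?thesis
    by (simp add: D_def h_def V_def)
qed

end

section \<open>Passage from the probabilistic hypotheses to the analysis, and conclusion\<close>

lemma standardized_me_rep_minimal_me:
  assumes "prob_space M" "standardized_me_rep M Y \<alpha> T" "minimal_me_rep \<alpha> T"
  shows "minimal_me \<alpha> T"
proof -
  interpret prob_space M by fact
  have D: "distributed M lborel Y (\<lambda>x. ennreal (me_density \<alpha> T x))"
    and nonneg: "\<And>x. me_density \<alpha> T x \<ge> 0"
    using assms(2) by (auto simp: standardized_me_rep_def)
  \<comment> \<open>\<open>distributed\<close> gives measurability of the \<open>ennreal\<close>
    version; nonnegativity recovers the real density from it.\<close>
  have "(\<lambda>x. enn2real (ennreal (me_density \<alpha> T x))) \<in> borel_measurable lborel"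
    using distributed_borel_measurable[OF D] by measurable
  then have "me_density \<alpha> T \<in> borel_measurable lborel"
    by (simp add: nonneg)
  moreover have "(\<integral>\<^sup>+x. ennreal (me_density \<alpha> T x) \<partial>lborel) = 1"
    using distributed_nn_integral[OF D, of "\<lambda>_. 1"] emeasure_space_1 by simp
  ultimately show ?thesis
    using assms(3) nonneg by unfold_locales auto
qed

lemma (in minimal_me) nn_integral_exp_me:
  assumes "standardized_me_rep M Y \<alpha> T" "\<theta> \<ge> 0"
  shows "(\<integral>\<^sup>+w. ennreal (exp (- \<theta> * Y w)) \<partial>M) = ennreal (me_laplace \<alpha> T \<theta>)"
  using distributed_nn_integral[of M lborel Y _ "\<lambda>x. ennreal (exp (- \<theta> * x))"] assms
    me_laplace_nn_integral[OF assms(2)]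
  by (simp add: standardized_me_rep_def)

theorem theorem2p3:
  fixes M :: "'w measure"
    and X B :: "real \<Rightarrow> 'w \<Rightarrow> real"
    and N :: "real \<Rightarrow> 'w \<Rightarrow> nat"
    and C :: "nat \<Rightarrow> 'w \<Rightarrow> real"
    and d \<sigma> rate q \<omega> \<eta> \<Phi> :: real
    and \<alpha> t :: "real ^ 'p"
    and T :: "real ^ 'p ^ 'p"
    and \<psi> W :: "real \<Rightarrow> real"
    and as :: "nat \<Rightarrow> real"
    and bs :: "nat \<Rightarrow> real ^ 'p"
  assumes prob: "prob_space M"
    and sigma_pos: "\<sigma> > 0" and rate_pos: "rate > 0"
    and brownian: "prob_space.standard_brownian_motion M B"
    and poisson: "prob_space.poisson_process M rate N"
    and iid_C: "prob_space.indep_vars M (\<lambda>_. borel) C {1..}"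
    and me_C: "\<And>j. j \<ge> 1 \<Longrightarrow> standardized_me_rep M (C j) \<alpha> T"
    and minimal: "minimal_me_rep \<alpha> T"
    and indep: "prob_space.independent_drivers M B N C"
    and X_def: "\<And>s w. s \<ge> 0 \<Longrightarrow> X s w = d * s + \<sigma> * B s w - (\<Sum>j=1..N s w. C j w)"
    and t_def: "t = exit_vector T"
    and psi_def: "\<psi> = laplace_exponent M X"
    and q_nonneg: "q \<ge> 0"
    and Phi_def: "\<Phi> = largest_root \<psi> q"
    and scale_W: "scale_function \<psi> q W"
    and deriv_pos: "laplace_exponent_deriv \<psi> \<Phi> > 0"
    and omega_def: "\<omega> = (sqrt (d\<^sup>2 + 2 * \<sigma>\<^sup>2 * (rate + q)) + d) / \<sigma>\<^sup>2"
    and eta_def: "\<eta> = (sqrt (d\<^sup>2 + 2 * \<sigma>\<^sup>2 * (rate + q)) - d) / \<sigma>\<^sup>2"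
    and as_0: "as 0 = \<omega>" and bs_0: "bs 0 = 0"
    and bs_Suc: "\<And>n. bs (Suc n) =
          ((2 * rate / \<sigma>\<^sup>2) *\<^sub>R \<alpha> + (\<omega> - as n) *\<^sub>R bs n) v* matrix_inv (mat \<eta> - T)"
    and as_Suc: "\<And>n. as (Suc n) =
          \<omega> - \<sigma>\<^sup>2 / (2 * sqrt (d\<^sup>2 + 2 * \<sigma>\<^sup>2 * (rate + q))) *
              ((\<omega> - as n)\<^sup>2 + bs (Suc n) \<bullet> t)"
  shows "\<exists>(a :: real) (b :: real ^ 'p).
           as \<longlonglongrightarrow> a \<and> (\<forall>i. (\<lambda>n. bs n $ i) \<longlonglongrightarrow> b $ i) \<and>
           \<sigma>\<^sup>2 * a\<^sup>2 - 2 * d * a - 2 * (rate + q) + \<sigma>\<^sup>2 * (b \<bullet> t) = 0 \<and>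
           \<sigma>\<^sup>2 *\<^sub>R (b v* (mat (a - 2 * d / \<sigma>\<^sup>2) - T)) = (2 * rate) *\<^sub>R \<alpha> \<and>
           (let \<Psi> = (1 / \<omega>) *\<^sub>R rowvector (block_vec (\<omega> - a) b) :: real ^ 'p option ^ 1;
                C_minus = block_mat (- \<omega>) 0 t T;
                D_minus_plus = columnvector (block_vec \<omega> 0) :: real ^ 1 ^ 'p option;
                G = C_minus + D_minus_plus ** \<Psi>;
                \<nu> = matrix_inv (mat \<Phi> - T) *v t;
                V = block_vec 1 \<nu>
            in G = block_mat (- a) b t T \<and>
               (\<forall>x\<ge>0. W x = 1 / laplace_exponent_deriv \<psi> \<Phi> *
                  (exp (\<Phi> * x) - axis None 1 \<bullet> (mat_exp (x *\<^sub>R G) *v V))))"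
proof -
  interpret prob_space M by fact
  interpret me: minimal_me \<alpha> T
    using standardized_me_rep_minimal_me[OF prob me_C[of 1] minimal] by simp
  define \<kappa> m where "\<kappa> = 2 * rate / \<sigma>\<^sup>2" and "m = 2 * d / \<sigma>\<^sup>2"
  have psi: "\<psi> \<theta> = d * \<theta> + \<sigma>\<^sup>2 / 2 * \<theta>\<^sup>2 + rate * (me_laplace \<alpha> T \<theta> - 1)" if "\<theta> \<ge> 0" for \<theta>
    unfolding psi_def
  proof (rule compound_poisson_exponent[OF brownian poisson rate_pos iid_C indep])
    show "X 1 w = d + \<sigma> * B 1 w - (\<Sum>j=1..N 1 w. C j w)" for w
      using X_def[of 1 w] by simp
    show "(\<integral>\<^sup>+w. ennreal (exp (- \<theta> * C j w)) \<partial>M) = ennreal (me_laplace \<alpha> T \<theta>)" if "j \<ge> 1" for j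
      by (rule me.nn_integral_exp_me[OF me_C[OF that] \<open>\<theta> \<ge> 0\<close>])
  qed (rule me.me_laplace_nonneg[OF that])
  interpret levy_exponent \<alpha> T d \<sigma> rate q \<omega> \<eta> \<kappa> m \<Phi> \<psi>
    by unfold_locales (fact sigma_pos rate_pos q_nonneg omega_def eta_def \<kappa>_def m_def psi Phi_def)+
  define a where "a = \<Phi> + m"
  define b where "b = (\<kappa> *\<^sub>R \<alpha>) v* matrix_inv (mat \<Phi> - T)"
  have bracket: "(\<theta> - \<eta>) * (\<theta> + \<omega>) + \<kappa> * me_laplace \<alpha> T \<theta> = 0 \<longleftrightarrow> \<psi> \<theta> = q" if "\<theta> \<ge> 0" for \<theta>
    using psi_quadratic[OF that] sigma_pos by auto
  have \<kappa>_nonneg: "\<kappa> \<ge> 0"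
    using rate_pos by (simp add: \<kappa>_def)
  have c_0: "\<omega> - as 0 = 0"
    by (simp add: as_0)
  have bs_rec: "bs (Suc n) = (\<kappa> *\<^sub>R \<alpha> + (\<omega> - as n) *\<^sub>R bs n) v* matrix_inv (mat \<eta> - T)" for n
    by (simp only: bs_Suc \<kappa>_def)
  \<comment> \<open>The factor in front of the bracket in \<open>as_Suc\<close> is
    \<open>1 / (\<omega> + \<eta>)\<close>.\<close>
  have c_rec: "\<omega> - as (Suc n) = ((\<omega> - as n)\<^sup>2 + bs (Suc n) \<bullet> exit_vector T) / (\<omega> + \<eta>)" for n
    unfolding as_Suc discriminant(5) t_def by simp
  have root: "(\<Phi> - \<eta>) * (\<Phi> + \<omega>) + \<kappa> * me_laplace \<alpha> T \<Phi> = 0"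
    using bracket[OF \<Phi>_nonneg] \<Phi>_root by simp
  have largest: "(\<theta> - \<eta>) * (\<theta> + \<omega>) + \<kappa> * me_laplace \<alpha> T \<theta> \<noteq> 0" if "\<theta> > \<Phi>" for \<theta>
    using bracket[of \<theta>] \<Phi>_largest[OF that] \<Phi>_nonneg that by auto
  note limits = me.iteration_converges[where c = "\<lambda>n. \<omega> - as n", OF discriminant(1,2) \<kappa>_nonneg c_0 bs_0
      bs_rec c_rec \<Phi>_nonneg \<Phi>_le_\<eta> root largest, folded b_def]
  \<comment> \<open>The limit is \<open>\<Phi> + m\<close>, since
    \<open>\<omega> - \<eta> = m\<close>.\<close>
  have "(\<lambda>n. \<omega> - (\<omega> - as n)) \<longlonglongrightarrow> \<omega> - (\<eta> - \<Phi>)"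
    by (intro tendsto_intros limits)
  then have as_lim: "as \<longlonglongrightarrow> a"
    using discriminant(3) by (simp add: a_def algebra_simps)
  have bs_lim: "(\<lambda>n. bs n $ i) \<longlonglongrightarrow> b $ i" for i
    by (intro tendsto_vec_nth limits)
  have bt: "b \<bullet> t = \<kappa> * me_laplace \<alpha> T \<Phi>"
    by (simp add: b_def t_def dot_lmul_matrix me_laplace_def)
  have "\<sigma>\<^sup>2 * a\<^sup>2 - 2 * d * a - 2 * (rate + q) + \<sigma>\<^sup>2 * (b \<bullet> t) = 2 * (\<psi> \<Phi> - q)"
  proof -
    \<comment> \<open>Stated for arbitrary \<open>s\<close> and \<open>l\<close>, so that the square
      of \<open>\<sigma>\<close> and the transform value stay opaque in the algebra.\<close>
    have "s * (\<Phi> + 2 * d / s)\<^sup>2 - 2 * d * (\<Phi> + 2 * d / s) - 2 * (rate + q) + s * (2 * rate / s * l) =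
        2 * (d * \<Phi> + s / 2 * \<Phi>\<^sup>2 + rate * (l - 1) - q)" if "s \<noteq> 0" for s l :: real
    proof -
      have "s * (\<Phi> + 2 * d / s)\<^sup>2 = s * \<Phi>\<^sup>2 + 4 * d * \<Phi> + 2 * d * (2 * d / s)"
        using that by (simp add: power2_eq_square distrib_left distrib_right add_divide_distrib)
      moreover have "s * (2 * rate / s * l) = 2 * rate * l"
        using that by simp
      ultimately show ?thesis
        by (simp add: algebra_simps)
    qed
    from this[of "\<sigma>\<^sup>2"] show ?thesis
      unfolding bt a_def m_def \<kappa>_def psi[OF \<Phi>_nonneg] using sigma_pos by simp
  qed
  then have eq1: "\<sigma>\<^sup>2 * a\<^sup>2 - 2 * d * a - 2 * (rate + q) + \<sigma>\<^sup>2 * (b \<bullet> t) = 0"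
    by (simp add: \<Phi>_root)
  have "a - 2 * d / \<sigma>\<^sup>2 = \<Phi>"
    by (simp add: a_def m_def)
  then have "b v* (mat (a - 2 * d / \<sigma>\<^sup>2) - T) = \<kappa> *\<^sub>R \<alpha>"
    by (simp add: b_def me.vec_resolvent_mult \<Phi>_nonneg)
  then have eq2: "\<sigma>\<^sup>2 *\<^sub>R (b v* (mat (a - 2 * d / \<sigma>\<^sup>2) - T)) = (2 * rate) *\<^sub>R \<alpha>"
    using sigma_pos by (simp add: \<kappa>_def)
  \<comment> \<open>The column has only its first entry nonzero, so the product affects only the
    first row, where \<open>\<omega>\<close> cancels against \<open>1 / \<omega>\<close>.\<close>
  have G: "block_mat (- \<omega>) 0 t T + (columnvector (block_vec \<omega> 0) :: real ^ 1 ^ 'p option) **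
      ((1 / \<omega>) *\<^sub>R rowvector (block_vec (\<omega> - a) b)) = block_mat (- a) b t T"
    using discriminant(1)
    by (simp add: vec_eq_iff block_mat_def block_vec_def columnvector_def rowvector_def
        matrix_matrix_mult_def split: option.split)
  have W_eq: "W x = 1 / laplace_exponent_deriv \<psi> \<Phi> *
      (exp (\<Phi> * x) - axis None 1 \<bullet>
        (mat_exp (x *\<^sub>R block_mat (- a) b t T) *v block_vec 1 (matrix_inv (mat \<Phi> - T) *v t)))"
    if "x \<ge> 0" for x
    using scale_function_formula[OF scale_W deriv_pos that] by (simp only: a_def b_def t_def)
  show ?thesis
    unfolding Let_def
    by (rule exI[of _ a], rule exI[of _ b], unfold G) (intro conjI allI impI refl as_lim bs_lim eq1 eq2 W_eq)
qed

end
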